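(* Assume that $N\geq 3$ and $4-N<\alpha<2$, and set $p^*_\alpha=\frac{2(N-\alpha)}{N-4+\alpha}$. Then the equation $$\Delta(|x|^{\alpha}\Delta u)=|x|^{-\alpha}|u|^{p^*_\alpha-2}u\quad\text{in }\mathbb{R}^N$$ has a unique (up to scaling) positive radial solution of the form $$U_{\lambda,\alpha}(x)=\frac{C_{N,\alpha}\lambda^{\frac{N-4+\alpha}{2}}}{(1+\lambda^{2-\alpha}|x|^{2-\alpha})^{\frac{N-4+\alpha}{2-\alpha}}},$$ with $\lambda>0$, where $C_{N,\alpha}=\left[(N-4+\alpha)(N-2)(N-\alpha)(N+2-2\alpha)\right]^{\frac{N-4+\alpha}{8-4\alpha}}$.
   Context: Here $N$ is the (integer) dimension of $\mathbb{R}^N$ and $\alpha$ is a real number. "Scaling" refers to the dilations $u\mapsto\lambda^{\frac{N-4+\alpha}{2}}u(\lambda x)$, $\lambda>0$, under which the equation is invariant. Up to scaling, the equation is the Euler-Lagrange equation of the weighted Caffarelli-Kohn-Nirenberg-type inequality $\int_{\mathbb{R}^N}|x|^{\alpha}|\Delta u|^2dx\geq S\left(\int_{\mathbb{R}^N}|x|^{-\alpha}|u|^{p^*_\alpha}dx\right)^{2/p^*_\alpha}$, $u\in C_c^\infty(\mathbb{R}^N)$, where $S$ is a constant depending on $N$ and $\alpha$. *)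

theory Defs
  imports "HOL-Analysis.Analysis"
begin

text \<open>Throughout, the dimension \<open>N\<close> is \<open>DIM('a)\<close> for a Euclidean space \<open>'a\<close>, and \<open>a\<close> is
  the real weight exponent.\<close>

definition partial_deriv :: "'a::euclidean_space \<Rightarrow> ('a \<Rightarrow> real) \<Rightarrow> 'a \<Rightarrow> real" where
  "partial_deriv i f x = frechet_derivative f (at x) i"

definition laplacian :: "('a::euclidean_space \<Rightarrow> real) \<Rightarrow> 'a \<Rightarrow> real" where
  "laplacian f x = (\<Sum>i\<in>Basis. partial_deriv i (partial_deriv i f) x)"

text \<open>The class \<open>C\<^sup>k(S)\<close>; intended for open \<open>S\<close> only, since derivatives are not taken within \<open>S\<close>.\<close>

primrec Ck_on :: "nat \<Rightarrow> ('a::euclidean_space \<Rightarrow> real) \<Rightarrow> 'a set \<Rightarrow> bool" where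
  "Ck_on 0 f S \<longleftrightarrow> continuous_on S f"
| "Ck_on (Suc k) f S \<longleftrightarrow>
     (\<forall>x\<in>S. f differentiable (at x)) \<and> (\<forall>i\<in>Basis. Ck_on k (partial_deriv i f) S)"

definition weighted_laplacian :: "real \<Rightarrow> ('a::euclidean_space \<Rightarrow> real) \<Rightarrow> 'a \<Rightarrow> real" where
  "weighted_laplacian a u x = norm x powr a * laplacian u x"

definition crit_exp :: "'a::euclidean_space itself \<Rightarrow> real \<Rightarrow> real" where
  "crit_exp _ a = 2 * (real DIM('a) - a) / (real DIM('a) - 4 + a)"

text \<open>Classical solutions of
  \<open>\<Delta>(|x|\<^sup>a \<Delta>u) = |x|\<^sup>-\<^sup>a |u|\<^sup>p\<^sup>-\<^sup>2 u\<close> in the whole space. The weights degenerate or blow up at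
  the origin, and for general \<open>a\<close> even the explicit solutions are not twice differentiable
  there. So the equation is imposed pointwise off the origin, while across the origin both \<open>u\<close>
  and \<open>|x|\<^sup>a \<Delta>u\<close> are required to be continuous. This makes the origin a removable singularity
  (the equation then holds in the sense of distributions on the whole space) and rules out
  singular solutions such as multiples of \<open>|x|\<close> to the power \<open>-(N - 4 + a) / 2\<close>.
  The value of \<open>weighted_laplacian a u\<close> at \<open>0\<close> itself carries no information, whence the limit.\<close>

definition is_solution :: "real \<Rightarrow> ('a::euclidean_space \<Rightarrow> real) \<Rightarrow> bool" where
  "is_solution a u \<longleftrightarrow>
     continuous_on UNIV u \<and>
     Ck_on 4 u (- {0}) \<and>
     (\<exists>L. (weighted_laplacian a u \<longlongrightarrow> L) (at 0)) \<and>
     (\<forall>x. x \<noteq> 0 \<longrightarrow>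
        laplacian (weighted_laplacian a u) x =
          norm x powr (- a) * (\<bar>u x\<bar> powr (crit_exp TYPE('a) a - 2) * u x))"

definition radial :: "('a::euclidean_space \<Rightarrow> real) \<Rightarrow> bool" where
  "radial u \<longleftrightarrow> (\<forall>x y. norm x = norm y \<longrightarrow> u x = u y)"

definition positive_radial_solution :: "real \<Rightarrow> ('a::euclidean_space \<Rightarrow> real) \<Rightarrow> bool" where
  "positive_radial_solution a u \<longleftrightarrow> is_solution a u \<and> radial u \<and> (\<forall>x. u x > 0)"

definition dilation :: "real \<Rightarrow> real \<Rightarrow> ('a::euclidean_space \<Rightarrow> real) \<Rightarrow> 'a \<Rightarrow> real" where
  "dilation a l u x = l powr ((real DIM('a) - 4 + a) / 2) * u (l *\<^sub>R x)"

definition bubble_const :: "'a::euclidean_space itself \<Rightarrow> real \<Rightarrow> real" where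
  "bubble_const _ a =
     (let N = real DIM('a)
      in ((N - 4 + a) * (N - 2) * (N - a) * (N + 2 - 2 * a)) powr ((N - 4 + a) / (8 - 4 * a)))"

definition bubble :: "real \<Rightarrow> real \<Rightarrow> 'a::euclidean_space \<Rightarrow> real" where
  "bubble a l x =
     (let N = real DIM('a)
      in bubble_const TYPE('a) a * l powr ((N - 4 + a) / 2) /
           (1 + l powr (2 - a) * norm x powr (2 - a)) powr ((N - 4 + a) / (2 - a)))"

end

theory Submission
  imports Defs
begin

text \<open>Write \<open>n\<close> for the dimension, \<open>\<gamma> = 2 - \<alpha>\<close> and \<open>q\<close> for the exponent of the right-hand side. A radial
  solution is governed by its profile \<open>\<phi>(r)\<close> and by \<open>\<psi>(r) = r\<^sup>\<alpha> \<Delta>u\<close>, and both equations of the resulting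
  system have the same left-hand side: \<open>(r\<^sup>n\<^sup>-\<^sup>1 y')' = r\<^sup>n\<^sup>-\<^sup>1\<^sup>-\<^sup>\<alpha> g\<close> with \<open>(y, g) = (\<phi>, \<psi>)\<close> and
  \<open>(y, g) = (\<psi>, \<phi>\<^sup>q)\<close>. (In the variable \<open>r\<^sup>\<gamma>\<^sup>/\<^sup>2\<close> this is, up to a constant factor, the critical biharmonic equation in the
  fractional dimension \<open>2(n - \<alpha>)/(2 - \<alpha>)\<close>.) Two facts about this operator drive the proof.

  \<^item> Boundedness at the origin forces the flux \<open>r\<^sup>n\<^sup>-\<^sup>1 y'\<close> to vanish there (lemma \<open>flux_nonpos\<close>), so that
    \<open>\<phi>\<close> and \<open>\<psi>\<close> are determined by \<open>\<phi>(0)\<close> and \<open>\<psi>(0)\<close> (lemma \<open>solution_determined_at_origin\<close>).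
  \<^item> The system is cooperative: larger \<open>\<psi>\<close> makes \<open>\<phi>\<close> larger, and larger \<open>\<phi>\<close> makes \<open>\<psi>\<close> larger
    (lemmas \<open>comparison_from_origin\<close> and \<open>comparison_from_positive_radius\<close>).

  The functions \<open>A (1 + \<kappa> r\<^sup>\<gamma>)\<^sup>-\<^sup>m\<close>, with \<open>A\<close> depending on \<open>\<bar>\<kappa>\<bar>\<close>, solve the system for both signs of \<open>\<kappa>\<close>
  (lemma \<open>profile_solves\<close>), since only \<open>\<kappa>\<^sup>2\<close> enters the last equation. For \<open>\<kappa> > 0\<close> they are the bubbles;
  for \<open>\<kappa> < 0\<close> they blow up at a finite radius.

  Given a positive solution \<open>\<phi>\<close>, take the bubble with the same value at the origin, and compare the
  values of \<open>\<psi>\<close> at the origin. If that of the solution is smaller, then the bubble exceeds \<open>\<phi>\<close> by a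
  multiple of \<open>r\<^sup>\<gamma>\<close>, which is impossible because bubbles are bounded and \<open>\<phi>\<close> is positive. If it is larger,
  then \<open>\<psi>\<close> exceeds that of the bubble by a positive constant; as the latter tends to \<open>0\<close> at infinity,
  \<open>\<phi>\<close>, \<open>\<psi>\<close> and both fluxes are positive at some radius. There a blow-up profile with small \<open>\<bar>\<kappa>\<bar>\<close> lies below
  the solution, and by comparison stays below it, so the solution cannot be continued past a finite
  radius (lemma \<open>no_growing_solution\<close>). Hence the two values agree, and the solution is the bubble.\<close>

section \<open>Functions of class \<open>C\<^sup>k\<close> on an open set\<close>

lemma partial_deriv_eq: "(f has_derivative f') (at x) \<Longrightarrow> partial_deriv i f x = f' i"
  by (simp add: partial_deriv_def frechet_derivative_at [symmetric])

lemma partial_deriv_cong: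
  assumes "open S" "x \<in> S" "\<And>y. y \<in> S \<Longrightarrow> f y = g y"
  shows "partial_deriv i f x = partial_deriv i g x"
proof -
  have "(f has_derivative f') (at x) = (g has_derivative f') (at x)" for f'
    using has_derivative_transform_within_open [OF _ assms(1,2), of f f' UNIV g]
      has_derivative_transform_within_open [OF _ assms(1,2), of g f' UNIV f] assms(3)
    by auto
  then show ?thesis
    by (simp add: partial_deriv_def frechet_derivative_def)
qed

lemma Ck_on_cong:
  assumes "open S" "\<And>x. x \<in> S \<Longrightarrow> f x = g x"
  shows "Ck_on k f S \<longleftrightarrow> Ck_on k g S"
  using assms(2)
proof (induction k arbitrary: f g)
  case 0
  then show ?case by (auto intro: continuous_on_cong)
next
  case (Suc k)
  have "f differentiable (at x) \<longleftrightarrow> g differentiable (at x)" if "x \<in> S" for x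
    unfolding differentiable_def
    using has_derivative_transform_within_open [OF _ assms(1) that, of f _ UNIV g]
      has_derivative_transform_within_open [OF _ assms(1) that, of g _ UNIV f] Suc.prems
    by (metis (no_types, lifting))
  moreover have "Ck_on k (partial_deriv i f) S \<longleftrightarrow> Ck_on k (partial_deriv i g) S" for i
    by (rule Suc.IH) (rule partial_deriv_cong [OF assms(1)], use Suc.prems in auto)
  ultimately show ?case by auto
qed

text \<open>Although the recursive clause asks only for differentiability of the function itself, the
  continuity demanded at the bottom of the recursion propagates upwards.\<close>

lemma Ck_on_lower: "Ck_on (Suc k) f S \<Longrightarrow> Ck_on k f S"
proof (induction k arbitrary: f)
  case 0
  then show ?case
    by (auto intro!: continuous_at_imp_continuous_on differentiable_imp_continuous_within)
qed auto

text \<open>Trades \<open>partial_deriv\<close> for an explicit derivative, so that closure properties follow from the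
  differentiation rules by induction on the order.\<close>

lemma Ck_on_Suc_I:
  assumes "open S"
    and "\<And>x. x \<in> S \<Longrightarrow> (f has_derivative f' x) (at x)"
    and "\<And>i. i \<in> Basis \<Longrightarrow> Ck_on k (\<lambda>x. f' x i) S"
  shows "Ck_on (Suc k) f S"
proof -
  have "Ck_on k (partial_deriv i f) S" if "i \<in> Basis" for i
    using Ck_on_cong [OF assms(1), of "partial_deriv i f" "\<lambda>x. f' x i" k]
      assms(2,3) that by (auto simp: partial_deriv_eq)
  then show ?thesis
    using assms(2) by (auto simp: differentiable_def)
qed

lemma Ck_on_has_derivative:
  assumes "Ck_on (Suc k) f S" "x \<in> S"
  shows "(f has_derivative (\<lambda>h. frechet_derivative f (at x) h)) (at x)"
  using assms by (simp add: frechet_derivative_works [symmetric])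

lemma Ck_on_const: "open S \<Longrightarrow> Ck_on k (\<lambda>x. c) S"
proof (induction k arbitrary: c)
  case (Suc k)
  then show ?case
    by (intro Ck_on_Suc_I [where f' = "\<lambda>x h. 0"]) auto
qed auto

lemma Ck_on_add:
  assumes "open S" "Ck_on k f S" "Ck_on k g S"
  shows "Ck_on k (\<lambda>x. f x + g x) S"
  using assms(2,3)
proof (induction k arbitrary: f g)
  case (Suc k)
  then show ?case
    by (intro Ck_on_Suc_I [OF assms(1) has_derivative_add [OF Ck_on_has_derivative [OF Suc.prems(1)]
              Ck_on_has_derivative [OF Suc.prems(2)]]])
      (auto intro!: Suc.IH simp: partial_deriv_def [abs_def])
qed (simp add: continuous_on_add continuous_on_mult)

lemma Ck_on_mult:
  assumes "open S" "Ck_on k f S" "Ck_on k g S"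
  shows "Ck_on k (\<lambda>x. f x * g x) S"
  using assms(2,3)
proof (induction k arbitrary: f g)
  case (Suc k)
  then show ?case
    by (intro Ck_on_Suc_I [OF assms(1) has_derivative_mult [OF Ck_on_has_derivative [OF Suc.prems(1)]
              Ck_on_has_derivative [OF Suc.prems(2)]]])
      (use Suc.prems in \<open>auto intro!: Suc.IH Ck_on_add assms(1)
          simp: partial_deriv_def [abs_def] simp del: Ck_on.simps
          intro: Ck_on_lower\<close>, auto simp: partial_deriv_def [abs_def])
qed (simp add: continuous_on_add continuous_on_mult)

lemma Ck_on_inner_const: "open S \<Longrightarrow> Ck_on k (\<lambda>x. x \<bullet> c) S"
proof (cases k)
  case (Suc j)
  assume "open S"
  then show ?thesis
    unfolding Suc by (intro Ck_on_Suc_I [where f' = "\<lambda>x h. h \<bullet> c"])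
      (auto intro!: derivative_eq_intros Ck_on_const)
qed (auto intro!: continuous_intros)

lemma Ck_on_inner_self: "open S \<Longrightarrow> Ck_on k (\<lambda>x. x \<bullet> x) S"
proof (cases k)
  case (Suc j)
  assume S: "open S"
  have "Ck_on j (\<lambda>x. x \<bullet> i + i \<bullet> x) S" for i
    using Ck_on_add [OF S Ck_on_inner_const [OF S] Ck_on_inner_const [OF S], of j i i]
    by (simp add: inner_commute)
  then show ?thesis
    unfolding Suc using S
    by (intro Ck_on_Suc_I [where f' = "\<lambda>x h. x \<bullet> h + h \<bullet> x"])
      (auto intro!: derivative_eq_intros)
qed (auto intro!: continuous_intros)

lemma Ck_on_powr:
  assumes "open S" "Ck_on k f S" "\<And>x. x \<in> S \<Longrightarrow> f x > 0"
  shows "Ck_on k (\<lambda>x. f x powr a) S"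
  using assms(2)
proof (induction k arbitrary: a)
  case 0
  then show ?case
    using assms(3) by (force intro!: continuous_intros)
next
  case (Suc k)
  have "((\<lambda>x. f x powr a) has_derivative
          (\<lambda>h. (a * f x powr (a - 1)) * frechet_derivative f (at x) h)) (at x)" if "x \<in> S" for x
  proof -
    have "((\<lambda>y. y powr a) has_derivative (\<lambda>h. (a * f x powr (a - 1)) * h)) (at (f x))"
      using has_real_derivative_powr [OF assms(3) [OF that], of a]
      by (simp add: has_field_derivative_def)
    then show ?thesis
      using has_derivative_compose [OF Ck_on_has_derivative [OF Suc.prems that]] by blast
  qed
  then show ?case
    using Suc.prems
    by (intro Ck_on_Suc_I [OF assms(1)])
      (auto intro!: Ck_on_mult Ck_on_const assms(1) Suc.IH Ck_on_lower [of k f]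
        simp: partial_deriv_def [abs_def])
qed

section \<open>The Laplacian of a radial function\<close>

lemma has_derivative_norm_at:
  fixes x :: "'a::euclidean_space"
  assumes "x \<noteq> 0"
  shows "(norm has_derivative (\<lambda>h. (x \<bullet> h) / norm x)) (at x)"
  using has_derivative_norm [OF assms] by (simp add: sgn_div_norm divide_inverse inner_commute mult.commute)

lemma has_derivative_compose_norm:
  fixes x :: "'a::euclidean_space"
  assumes "(f has_real_derivative d) (at (norm x))" "x \<noteq> 0"
  shows "((\<lambda>y. f (norm y)) has_derivative (\<lambda>h. d * ((x \<bullet> h) / norm x))) (at x)"
  by (rule has_derivative_compose [OF has_derivative_norm_at [OF assms(2)]
        assms(1) [unfolded has_field_derivative_def]])

text \<open>In polar coordinates the Laplacian of a radial function is \<open>r\<^sup>1\<^sup>-\<^sup>n (r\<^sup>n\<^sup>-\<^sup>1 f')'\<close>. Passing through the flux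
  \<open>p = r\<^sup>n\<^sup>-\<^sup>1 f'\<close> avoids second derivatives of \<open>f\<close>: the gradient is \<open>r\<^sup>-\<^sup>n p\<close> times the position vector.\<close>

lemma laplacian_radial:
  fixes u :: "'a::euclidean_space \<Rightarrow> real"
  defines "n \<equiv> real DIM('a)"
  assumes u: "\<And>x. x \<noteq> 0 \<Longrightarrow> u x = f (norm x)"
    and f: "\<And>r. r > 0 \<Longrightarrow> (f has_real_derivative r powr (1 - n) * p r) (at r)"
    and p: "\<And>r. r > 0 \<Longrightarrow> (p has_real_derivative g r) (at r)"
    and "x \<noteq> 0"
  shows "laplacian u x = norm x powr (1 - n) * g (norm x)"
proof -
  have op: "open (- {0::'a})" by auto
  define F where "F r = r powr (- n) * p r" for r
  define F' where "F' r = r powr (- n) * g r - n * r powr (- n - 1) * p r" for r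
  have F: "(F has_real_derivative F' r) (at r)" if "r > 0" for r
    unfolding F_def F'_def using that
    by (auto intro!: derivative_eq_intros p simp: powr_diff)
  have du: "partial_deriv i u y = F (norm y) * (y \<bullet> i)" if "y \<noteq> 0" for i y
  proof -
    have "((\<lambda>y. f (norm y)) has_derivative
             (\<lambda>h. norm y powr (1 - n) * p (norm y) * ((y \<bullet> h) / norm y))) (at y)"
      using that by (intro has_derivative_compose_norm f) auto
    then have "partial_deriv i (\<lambda>y. f (norm y)) y
        = norm y powr (1 - n) * p (norm y) * ((y \<bullet> i) / norm y)"
      by (rule partial_deriv_eq)
    moreover have "partial_deriv i u y = partial_deriv i (\<lambda>y. f (norm y)) y"
      using that by (intro partial_deriv_cong [OF op]) (auto simp: u)
    moreover have "norm y powr (1 - n) = norm y powr (- n) * norm y"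
      using that powr_add [of "norm y" "-n" 1] by simp
    ultimately show ?thesis
      using that by (simp add: F_def)
  qed
  have ddu: "partial_deriv i (partial_deriv i u) x
       = F' (norm x) / norm x * (x \<bullet> i)\<^sup>2 + F (norm x)" if "i \<in> Basis" for i
  proof -
    have "((\<lambda>y. F (norm y)) has_derivative (\<lambda>h. F' (norm x) * ((x \<bullet> h) / norm x))) (at x)"
      using \<open>x \<noteq> 0\<close> by (intro has_derivative_compose_norm F) auto
    then have "((\<lambda>y. F (norm y) * (y \<bullet> i)) has_derivative
        (\<lambda>h. F (norm x) * (h \<bullet> i) + F' (norm x) * ((x \<bullet> h) / norm x) * (x \<bullet> i))) (at x)"
      by (intro has_derivative_mult has_derivative_inner_left has_derivative_ident)
    then have "partial_deriv i (\<lambda>y. F (norm y) * (y \<bullet> i)) x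
       = F (norm x) * (i \<bullet> i) + F' (norm x) * ((x \<bullet> i) / norm x) * (x \<bullet> i)"
      by (rule partial_deriv_eq)
    moreover have "partial_deriv i (partial_deriv i u) x
        = partial_deriv i (\<lambda>y. F (norm y) * (y \<bullet> i)) x"
      using \<open>x \<noteq> 0\<close> by (intro partial_deriv_cong [OF op]) (auto simp: du)
    ultimately show ?thesis
      using that by (simp add: power2_eq_square)
  qed
  have "laplacian u x = F' (norm x) / norm x * (\<Sum>i\<in>Basis. (x \<bullet> i)\<^sup>2) + n * F (norm x)"
    by (simp add: laplacian_def ddu sum.distrib sum_distrib_left n_def)
  also have "(\<Sum>i\<in>Basis. (x \<bullet> i)\<^sup>2) = (norm x)\<^sup>2"
    unfolding power2_norm_eq_inner by (subst euclidean_inner) (simp add: power2_eq_square)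
  also have "F' (norm x) / norm x * (norm x)\<^sup>2 + n * F (norm x)
      = norm x powr (1 - n) * g (norm x)"
  proof -
    have "(X * a - n * (X / s) * b) / s * s\<^sup>2 + n * (X * b) = X * s * a" if "s \<noteq> 0" for X a b s :: real
      using that by (simp add: field_simps power2_eq_square)
    from this [of "norm x" "norm x powr (- n)"] show ?thesis
      using \<open>x \<noteq> 0\<close> powr_add [of "norm x" "-n" 1] by (simp add: F_def F'_def powr_diff)
  qed
  finally show ?thesis .
qed

section \<open>The radial equation in flux form\<close>

locale weighted_radial =
  fixes n \<alpha> :: real
  assumes n_gt: "2 < n" and \<alpha>_lt: "\<alpha> < 2" and \<alpha>_gt: "4 - n < \<alpha>"
begin

definition "\<gamma> = 2 - \<alpha>"

text \<open>The equation \<open>(r\<^sup>n\<^sup>-\<^sup>1 y')' = r\<^sup>n\<^sup>-\<^sup>1\<^sup>-\<^sup>\<alpha> g\<close> at the point \<open>r\<close>, as a first order system for \<open>y\<close> and its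
  flux \<open>p = r\<^sup>n\<^sup>-\<^sup>1 y'\<close>.\<close>

definition flux :: "(real \<Rightarrow> real) \<Rightarrow> (real \<Rightarrow> real) \<Rightarrow> (real \<Rightarrow> real) \<Rightarrow> real \<Rightarrow> bool" where
  "flux y p g r \<longleftrightarrow> (y has_real_derivative r powr (1 - n) * p r) (at r) \<and>
                 (p has_real_derivative r powr (n - 1 - \<alpha>) * g r) (at r)"

lemma \<gamma>_pos: "\<gamma> > 0" and n\<alpha>_pos: "n - \<alpha> > 0"
  using n_gt \<alpha>_lt \<alpha>_gt by (auto simp: \<gamma>_def)

lemma flux_diff:
  assumes "flux y p g r" "flux z s h r"
  shows "flux (\<lambda>r. y r - z r) (\<lambda>r. p r - s r) (\<lambda>r. g r - h r) r"
  using assms unfolding flux_def right_diff_distrib by (auto intro: DERIV_diff)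

lemma flux_minus:
  assumes "flux y p g r"
  shows "flux (\<lambda>r. - y r) (\<lambda>r. - p r) (\<lambda>r. - g r) r"
  using assms unfolding flux_def mult_minus_right by (auto intro: DERIV_minus)

lemma flux_cmult:
  assumes "flux y p g r"
  shows "flux (\<lambda>r. c * y r) (\<lambda>r. c * p r) (\<lambda>r. c * g r) r"
  using assms unfolding flux_def mult.left_commute [of _ c] by (auto intro: DERIV_cmult)

text \<open>The solution with constant right-hand side and vanishing flux at the origin, against which others are compared.\<close>

lemma flux_power:
  assumes "r > 0"
  shows "flux (\<lambda>r. G / ((n - \<alpha>) * \<gamma>) * r powr \<gamma>) (\<lambda>r. G / (n - \<alpha>) * r powr (n - \<alpha>)) (\<lambda>r. G) r"
proof -
  have "((\<lambda>r. G / ((n - \<alpha>) * \<gamma>) * r powr \<gamma>) has_real_derivative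
          G / (n - \<alpha>) * r powr (\<gamma> - 1)) (at r)"
    using assms \<gamma>_pos n\<alpha>_pos by (auto intro!: derivative_eq_intros)
  moreover have "((\<lambda>r. G / (n - \<alpha>) * r powr (n - \<alpha>)) has_real_derivative
          G * r powr (n - \<alpha> - 1)) (at r)"
    using assms n\<alpha>_pos by (auto intro!: derivative_eq_intros)
  moreover have "r powr (\<gamma> - 1) = r powr (1 - n) * r powr (n - \<alpha>)"
    by (simp add: \<gamma>_def flip: powr_add)
  moreover have "n - \<alpha> - 1 = n - 1 - \<alpha>" by simp
  ultimately show ?thesis
    unfolding flux_def by (simp add: mult.commute mult.left_commute)
qed

lemma tendsto_powr_zero: "a > 0 \<Longrightarrow> ((\<lambda>r. r powr a) \<longlongrightarrow> 0) (at_right (0::real))"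
  by (intro tendsto_zero_powrI [where b = a] tendsto_ident_at)
    (auto intro!: tendsto_intros eventually_at_rightI [of 0 1])

text \<open>The maximum principle at the singular point. A flux above some \<open>k > 0\<close> near the origin would give
  \<open>y' \<ge> k r\<^sup>1\<^sup>-\<^sup>n\<close>, which is not integrable at \<open>0\<close> because \<open>n > 2\<close>, contradicting the existence of the limit of \<open>y\<close>.
  Since the flux is nonincreasing, it cannot be positive anywhere.\<close>

lemma flux_nonpos:
  assumes "R > 0"
    and flux: "\<And>r. 0 < r \<Longrightarrow> r \<le> R \<Longrightarrow> flux y p g r"
    and g: "\<And>r. 0 < r \<Longrightarrow> r \<le> R \<Longrightarrow> g r \<le> 0"
    and y: "(y \<longlongrightarrow> c) (at_right 0)"
  shows "p R \<le> 0" and "y R \<le> c"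
proof -
  have ev: "eventually (\<lambda>r. 0 < r \<and> r \<le> S) (at_right (0::real))" if "S > 0" for S
    using that eventually_at_right [of 0 S] by (auto intro!: exI [of _ S])
  have p_le: "p S \<le> 0" if S: "0 < S" "S \<le> R" for S
  proof (rule ccontr)
    assume "\<not> p S \<le> 0"
    define k where "k = p S"
    have "k > 0" using \<open>\<not> p S \<le> 0\<close> by (simp add: k_def)
    have p_ge: "p r \<ge> k" if r: "0 < r" "r \<le> S" for r
      unfolding k_def
    proof (rule DERIV_nonpos_imp_nonincreasing [OF r(2)])
      fix x assume "r \<le> x" "x \<le> S"
      then show "\<exists>d. (p has_real_derivative d) (at x) \<and> d \<le> 0"
        using flux [of x] g [of x] r S
        by (intro exI [of _ "x powr (n - 1 - \<alpha>) * g x"]) (auto simp: flux_def mult_nonneg_nonpos)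
    qed
    \<comment> \<open>The derivative of the added term is \<open>- k r\<^sup>1\<^sup>-\<^sup>n\<close>; it tends to infinity at the origin.\<close>
    define z where "z r = y r + k / (n - 2) * r powr (2 - n)" for r
    have z_le: "z r \<le> z S" if r: "0 < r" "r \<le> S" for r
    proof (rule DERIV_nonneg_imp_nondecreasing [OF r(2)])
      fix x assume x: "r \<le> x" "x \<le> S"
      have "(y has_real_derivative x powr (1 - n) * p x) (at x)"
        using flux [of x] r S x by (simp add: flux_def)
      moreover have "((\<lambda>r. k / (n - 2) * r powr (2 - n)) has_real_derivative
           - k * x powr (1 - n)) (at x)"
      proof -
        have "k / (n - 2) * (2 - n) = - k"
          using n_gt by (simp add: field_simps)
        moreover have "((\<lambda>r. k / (n - 2) * r powr (2 - n)) has_real_derivative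
            k / (n - 2) * ((2 - n) * x powr (1 - n))) (at x)"
          using n_gt r x by (auto intro!: derivative_eq_intros)
        ultimately show ?thesis
          unfolding mult.assoc [symmetric] by simp
      qed
      ultimately have "(z has_real_derivative x powr (1 - n) * p x + - k * x powr (1 - n)) (at x)"
        unfolding z_def [abs_def] by (rule DERIV_add)
      moreover have "x powr (1 - n) * k \<le> x powr (1 - n) * p x"
        using p_ge [of x] r x by (intro mult_left_mono) auto
      ultimately show "\<exists>d. (z has_real_derivative d) (at x) \<and> d \<ge> 0"
        by (intro exI conjI) (auto simp: algebra_simps)
    qed
    have pw: "((\<lambda>r. r powr (n - 2)) \<longlongrightarrow> 0) (at_right (0::real))"
      using n_gt by (intro tendsto_powr_zero) simp
    have "k / (n - 2) \<le> 0"
    proof (rule tendsto_le [OF trivial_limit_at_right_real])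
      show "((\<lambda>r. y r * r powr (n - 2) + k / (n - 2)) \<longlongrightarrow> k / (n - 2)) (at_right 0)"
        using tendsto_add [OF tendsto_mult [OF y pw] tendsto_const [of "k / (n - 2)"]] by simp
      show "((\<lambda>r. z S * r powr (n - 2)) \<longlongrightarrow> 0) (at_right 0)"
        using tendsto_mult [OF tendsto_const [of "z S"] pw] by simp
      show "\<forall>\<^sub>F r in at_right 0. y r * r powr (n - 2) + k / (n - 2) \<le> z S * r powr (n - 2)"
      proof (rule eventually_mono [OF ev [OF S(1)]])
        fix r assume r: "0 < r \<and> r \<le> S"
        have "z r * r powr (n - 2) \<le> z S * r powr (n - 2)"
          using z_le [of r] r by (intro mult_right_mono) auto
        moreover have "r powr (2 - n) * r powr (n - 2) = 1"
          using r by (simp flip: powr_add)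
        ultimately show "y r * r powr (n - 2) + k / (n - 2) \<le> z S * r powr (n - 2)"
          by (simp add: z_def distrib_right mult.assoc)
      qed
    qed
    with \<open>k > 0\<close> n_gt show False by (simp add: divide_le_0_iff)
  qed
  then show "p R \<le> 0" using \<open>R > 0\<close> by simp
  have y_ge: "y R \<le> y r" if r: "0 < r" "r \<le> R" for r
  proof (rule DERIV_nonpos_imp_nonincreasing [OF r(2)])
    fix x assume "r \<le> x" "x \<le> R"
    then show "\<exists>d. (y has_real_derivative d) (at x) \<and> d \<le> 0"
      using flux [of x] p_le [of x] r
      by (intro exI [of _ "x powr (1 - n) * p x"]) (auto simp: flux_def mult_nonneg_nonpos)
  qed
  show "y R \<le> c"
    by (rule tendsto_lowerbound [OF y]) (use y_ge in \<open>auto intro!: eventually_mono [OF ev [OF \<open>R > 0\<close>]]\<close>)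
qed

lemma flux_ge:
  assumes "R > 0"
    and flux: "\<And>r. 0 < r \<Longrightarrow> r \<le> R \<Longrightarrow> flux y p g r"
    and g: "\<And>r. 0 < r \<Longrightarrow> r \<le> R \<Longrightarrow> g r \<ge> G"
    and y: "(y \<longlongrightarrow> c) (at_right 0)"
  shows "p R \<ge> G / (n - \<alpha>) * R powr (n - \<alpha>)"
    and "y R \<ge> c + G / ((n - \<alpha>) * \<gamma>) * R powr \<gamma>"
proof -
  have *: "((\<lambda>r. G / ((n - \<alpha>) * \<gamma>) * r powr \<gamma> - y r) \<longlongrightarrow> - c) (at_right 0)"
    using tendsto_diff [OF tendsto_mult [OF tendsto_const [of "G / ((n - \<alpha>) * \<gamma>)"]
          tendsto_powr_zero [OF \<gamma>_pos]] y] by simp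
  show "p R \<ge> G / (n - \<alpha>) * R powr (n - \<alpha>)"
    and "y R \<ge> c + G / ((n - \<alpha>) * \<gamma>) * R powr \<gamma>"
    using flux_nonpos [OF \<open>R > 0\<close> flux_diff [OF flux_power [of _ G] flux] _ *] g by auto
qed

lemma flux_exp:
  assumes "r > 0"
  shows "flux (\<lambda>r. exp (K * r powr \<gamma>))
              (\<lambda>r. K * \<gamma> * r powr (n - \<alpha>) * exp (K * r powr \<gamma>))
              (\<lambda>r. K * \<gamma> * (n - \<alpha> + K * \<gamma> * r powr \<gamma>) * exp (K * r powr \<gamma>)) r"
proof -
  have "r powr (\<gamma> - 1) = r powr (1 - n) * r powr (n - \<alpha>)"
    "r powr (n - \<alpha>) * r powr (\<gamma> - 1) = r powr (n - 1 - \<alpha>) * r powr \<gamma>"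
    by (simp_all add: \<gamma>_def algebra_simps flip: powr_add)
  moreover have "n - \<alpha> - 1 = n - 1 - \<alpha>" by simp
  ultimately show ?thesis
    unfolding flux_def using assms
    by (auto intro!: derivative_eq_intros simp: algebra_simps)
qed

text \<open>The exponential \<open>E = exp (K r\<^sup>\<gamma>)\<close> satisfies the flux equation with a right-hand side of at least
  \<open>K \<gamma> (n - \<alpha>) E\<close>. Inverting the operator therefore gains an arbitrarily small factor for large \<open>K\<close>,
  which makes the solution map a contraction in the norm weighted by \<open>1 / E\<close>.\<close>

lemma flux_exp_bound:
  assumes "R > 0" "K > 0" "A \<ge> 0"
    and flux: "\<And>r. 0 < r \<Longrightarrow> r \<le> R \<Longrightarrow> flux y p g r"
    and g: "\<And>r. 0 < r \<Longrightarrow> r \<le> R \<Longrightarrow> \<bar>g r\<bar> \<le> A * exp (K * r powr \<gamma>)"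
    and y: "(y \<longlongrightarrow> 0) (at_right 0)"
  shows "\<bar>y R\<bar> \<le> A / (K * \<gamma> * (n - \<alpha>)) * exp (K * R powr \<gamma>)"
proof -
  define c where "c = A / (K * \<gamma> * (n - \<alpha>))"
  have c: "c \<ge> 0" "c * (K * \<gamma> * (n - \<alpha>)) = A"
    using assms(2,3) \<gamma>_pos n\<alpha>_pos by (auto simp: c_def)
  define E where "E r = exp (K * r powr \<gamma>)" for r
  define h where "h r = c * (K * \<gamma> * (n - \<alpha> + K * \<gamma> * r powr \<gamma>) * E r)" for r
  have cE: "flux (\<lambda>r. c * E r) (\<lambda>r. c * (K * \<gamma> * r powr (n - \<alpha>) * E r)) h r" if "r > 0" for r
    using flux_cmult [OF flux_exp [OF that]] by (simp add: E_def [abs_def] h_def [abs_def])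
  have h: "A * E r \<le> h r" for r
  proof -
    have "h r = A * E r + c * (K * \<gamma>)\<^sup>2 * r powr \<gamma> * E r"
      unfolding h_def c(2) [symmetric] by (simp add: algebra_simps power2_eq_square)
    then show ?thesis using c(1) by (simp add: E_def)
  qed
  have E0: "((\<lambda>r. c * E r) \<longlongrightarrow> c) (at_right 0)"
    using tendsto_mult [OF tendsto_const [of c] tendsto_exp [OF tendsto_mult [OF tendsto_const [of K]
            tendsto_powr_zero [OF \<gamma>_pos]]]] by (simp add: E_def)
  have "y R - c * E R \<le> 0 - c"
    by (rule flux_nonpos(2) [OF \<open>R > 0\<close> flux_diff [OF flux cE] _ tendsto_diff [OF y E0]])
      (use g h in \<open>fastforce simp: E_def abs_le_iff intro: order_trans\<close>)+
  moreover have "- y R - c * E R \<le> - 0 - c"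
    by (rule flux_nonpos(2) [OF \<open>R > 0\<close> flux_diff [OF flux_minus [OF flux] cE] _
            tendsto_diff [OF tendsto_minus [OF y] E0]])
      (use g h in \<open>fastforce simp: E_def abs_le_iff intro: order_trans\<close>)+
  ultimately show ?thesis
    using c(1) by (simp add: c_def E_def)
qed

end

section \<open>Comparison\<close>

text \<open>Consider the first zero: below it the function is positive, hence nonnegative up to and including
  that point, where the last implication then contradicts the vanishing.\<close>

lemma positive_by_continuation:
  fixes f :: "real \<Rightarrow> real"
  assumes "a < c" and near: "\<And>x. a < x \<Longrightarrow> x < c \<Longrightarrow> f x > 0"
    and cont: "\<And>x. a < x \<Longrightarrow> x \<le> b \<Longrightarrow> isCont f x"
    and step: "\<And>x. a < x \<Longrightarrow> x \<le> b \<Longrightarrow> (\<And>y. a < y \<Longrightarrow> y \<le> x \<Longrightarrow> f y \<ge> 0) \<Longrightarrow> f x > 0"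
    and "a < b"
  shows "f b > 0"
proof (rule ccontr)
  assume "\<not> f b > 0"
  define Z where "Z = {x. a < x \<and> x \<le> b \<and> f x \<le> 0}"
  define t where "t = Inf Z"
  have "b \<in> Z" using \<open>\<not> f b > 0\<close> \<open>a < b\<close> by (simp add: Z_def)
  have bdd: "bdd_below Z" by (auto simp: Z_def intro!: bdd_belowI [of _ a])
  have "c \<le> t" unfolding t_def
    by (rule cInf_greatest) (use \<open>b \<in> Z\<close> near in \<open>force simp: Z_def\<close>)+
  have "t \<le> b" unfolding t_def by (rule cInf_lower [OF \<open>b \<in> Z\<close> bdd])
  have "a < t" using \<open>a < c\<close> \<open>c \<le> t\<close> by simp
  have below: "f y > 0" if "a < y" "y < t" for y
    using cInf_lower [OF _ bdd, of y] that \<open>t \<le> b\<close> by (force simp: t_def Z_def)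
  have "f t \<ge> 0"
  proof (rule tendsto_lowerbound)
    show "(f \<longlongrightarrow> f t) (at_left t)"
      using cont [OF \<open>a < t\<close> \<open>t \<le> b\<close>] by (simp add: isCont_def filterlim_at_split)
    show "\<forall>\<^sub>F y in at_left t. f y \<ge> 0"
      using below \<open>a < t\<close> by (auto intro!: eventually_at_leftI [of a] less_imp_le)
  qed simp
  then have "f y \<ge> 0" if "a < y" "y \<le> t" for y
    using below [OF that(1)] that(2) by (cases "y = t") auto
  then have "f t > 0" using step \<open>a < t\<close> \<open>t \<le> b\<close> by blast
  then have "\<forall>\<^sub>F y in at t. f y > 0"
    using cont [OF \<open>a < t\<close> \<open>t \<le> b\<close>] by (auto simp: isCont_def intro: order_tendstoD(1))
  then obtain e where "e > 0" and e: "\<And>y. y \<noteq> t \<Longrightarrow> dist y t < e \<Longrightarrow> f y > 0"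
    by (auto simp: eventually_at)
  obtain z where "z \<in> Z" "z < t + e"
    using \<open>e > 0\<close> \<open>b \<in> Z\<close> cInf_lessD [of Z "t + e"] by (auto simp: t_def)
  moreover have "t \<le> z" unfolding t_def by (rule cInf_lower [OF \<open>z \<in> Z\<close> bdd])
  ultimately have "f z > 0"
    using e [of z] \<open>f t > 0\<close> by (cases "z = t") (auto simp: dist_real_def)
  with \<open>z \<in> Z\<close> show False by (simp add: Z_def)
qed

context weighted_radial
begin

text \<open>The exponent \<open>p\<^sup>* - 1\<close>, where \<open>p\<^sup>*\<close> is the critical exponent.\<close>

definition "q = (n + 4 - 3 * \<alpha>) / (n - 4 + \<alpha>)"

definition solves ::
    "(real \<Rightarrow> real) \<Rightarrow> (real \<Rightarrow> real) \<Rightarrow> (real \<Rightarrow> real) \<Rightarrow> (real \<Rightarrow> real) \<Rightarrow> real \<Rightarrow> bool" where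
  "solves \<phi> p \<psi> P r \<longleftrightarrow> flux \<phi> p \<psi> r \<and> flux \<psi> P (\<lambda>r. \<phi> r powr q) r"

lemma q_gt_1: "q > 1"
  using n_gt \<alpha>_lt \<alpha>_gt by (simp add: q_def field_simps)

lemma flux_isCont: "flux y p g r \<Longrightarrow> isCont y r"
  by (auto simp: flux_def intro: DERIV_isCont)

lemma flux_mono:
  assumes "0 < a" "a \<le> b"
    and flux: "\<And>r. a \<le> r \<Longrightarrow> r \<le> b \<Longrightarrow> flux y p g r"
    and g: "\<And>r. a \<le> r \<Longrightarrow> r \<le> b \<Longrightarrow> g r \<ge> 0"
    and "p a \<ge> 0"
  shows "p b \<ge> 0" and "y a \<le> y b"
proof -
  have p: "p a \<le> p r" if r: "a \<le> r" "r \<le> b" for r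
  proof (rule DERIV_nonneg_imp_nondecreasing [OF r(1)])
    fix x assume "a \<le> x" "x \<le> r"
    then show "\<exists>d. (p has_real_derivative d) (at x) \<and> d \<ge> 0"
      using flux [of x] g [of x] r
      by (intro exI [of _ "x powr (n - 1 - \<alpha>) * g x"]) (auto simp: flux_def)
  qed
  from p [of b] show "p b \<ge> 0" using assms by simp
  show "y a \<le> y b"
  proof (rule DERIV_nonneg_imp_nondecreasing [OF \<open>a \<le> b\<close>])
    fix x assume "a \<le> x" "x \<le> b"
    then show "\<exists>d. (y has_real_derivative d) (at x) \<and> d \<ge> 0"
      using flux [of x] p [of x] \<open>p a \<ge> 0\<close>
      by (intro exI [of _ "x powr (1 - n) * p x"]) (auto simp: flux_def)
  qed
qed

text \<open>As long as \<open>\<phi>1 \<le> \<phi>2\<close>, the right-hand side of the equation for \<open>\<psi>2 - \<psi>1\<close> is nonnegative, hence so is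
  \<open>\<psi>2 - \<psi>1\<close>, hence \<open>\<phi>2 - \<phi>1\<close> is nondecreasing and cannot reach zero.\<close>

lemma comparison_from_positive_radius:
  assumes "0 < a" "a \<le> b"
    and sol: "\<And>r. a \<le> r \<Longrightarrow> r \<le> b \<Longrightarrow> solves \<phi>1 p1 \<psi>1 P1 r"
      "\<And>r. a \<le> r \<Longrightarrow> r \<le> b \<Longrightarrow> solves \<phi>2 p2 \<psi>2 P2 r"
    and pos: "\<And>r. a \<le> r \<Longrightarrow> r \<le> b \<Longrightarrow> \<phi>1 r > 0"
    and init: "\<phi>1 a < \<phi>2 a" "p1 a \<le> p2 a" "\<psi>1 a \<le> \<psi>2 a" "P1 a \<le> P2 a"
  shows "\<phi>1 b < \<phi>2 b"
proof (cases "a = b")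
  case False
  define d where "d r = \<phi>2 r - \<phi>1 r" for r
  have flux: "flux d (\<lambda>r. p2 r - p1 r) (\<lambda>r. \<psi>2 r - \<psi>1 r) r"
    "flux (\<lambda>r. \<psi>2 r - \<psi>1 r) (\<lambda>r. P2 r - P1 r) (\<lambda>r. \<phi>2 r powr q - \<phi>1 r powr q) r"
    if "a \<le> r" "r \<le> b" for r
    using sol [OF that] by (auto simp: solves_def d_def [abs_def] intro: flux_diff)
  have cont: "isCont d r" if "a \<le> r" "r \<le> b" for r
    using flux(1) [OF that] by (rule flux_isCont)
  have "(d \<longlongrightarrow> d a) (at a)" "0 < d a"
    using cont [of a] \<open>a \<le> b\<close> init(1) by (simp_all add: isCont_def d_def)
  then have "\<forall>\<^sub>F r in at a. d r > 0"
    by (rule order_tendstoD(1))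
  then obtain e where "e > 0" and e: "\<And>r. r \<noteq> a \<Longrightarrow> dist r a < e \<Longrightarrow> d r > 0"
    by (auto simp: eventually_at)
  have "d b > 0"
  proof (rule positive_by_continuation [where f = d and a = a and c = "a + e"])
    fix x assume "a < x" "x \<le> b" and nonneg: "\<And>y. a < y \<Longrightarrow> y \<le> x \<Longrightarrow> d y \<ge> 0"
    have "\<phi>2 r powr q - \<phi>1 r powr q \<ge> 0" if "a \<le> r" "r \<le> x" for r
    proof -
      have "\<phi>1 r \<le> \<phi>2 r"
        using nonneg [of r] that init(1) by (cases "r = a") (auto simp: d_def)
      then show ?thesis
        using pos [of r] that \<open>x \<le> b\<close> q_gt_1 by (auto intro: powr_mono2)
    qed
    then have "\<psi>2 r - \<psi>1 r \<ge> 0" if "a \<le> r" "r \<le> x" for r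
      using flux_mono(2) [OF \<open>0 < a\<close> that(1) flux(2)] that \<open>x \<le> b\<close> init by fastforce
    then have "d a \<le> d x"
      using \<open>a < x\<close> \<open>x \<le> b\<close> init by (intro flux_mono(2) [OF \<open>0 < a\<close> _ flux(1)]) auto
    then show "d x > 0" using init(1) by (simp add: d_def)
  qed (use \<open>e > 0\<close> e cont \<open>a \<le> b\<close> False in \<open>auto simp: dist_real_def\<close>)
  then show ?thesis by (simp add: d_def)
qed (use init in simp)

text \<open>Here the functions \<open>\<phi>\<close> start with equal values, and the gap between the values of \<open>\<psi>\<close> opens the gap between them.
  The fluxes need no initial condition, since they vanish at the origin.\<close>

lemma comparison_from_origin:
  assumes sol: "\<And>r. r > 0 \<Longrightarrow> solves \<phi>1 p1 \<psi>1 P1 r" "\<And>r. r > 0 \<Longrightarrow> solves \<phi>2 p2 \<psi>2 P2 r"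
    and pos: "\<And>r. r > 0 \<Longrightarrow> \<phi>1 r > 0"
    and \<phi>: "(\<phi>1 \<longlongrightarrow> c) (at_right 0)" "(\<phi>2 \<longlongrightarrow> c) (at_right 0)"
    and \<psi>: "(\<psi>1 \<longlongrightarrow> b1) (at_right 0)" "(\<psi>2 \<longlongrightarrow> b2) (at_right 0)"
    and "b1 < b2" "R > 0"
  shows "\<psi>2 R \<ge> \<psi>1 R + (b2 - b1)"
    and "p2 R \<ge> p1 R + (b2 - b1) / (n - \<alpha>) * R powr (n - \<alpha>)"
    and "\<phi>2 R \<ge> \<phi>1 R + (b2 - b1) / ((n - \<alpha>) * \<gamma>) * R powr \<gamma>"
proof -
  define b where "b = b2 - b1"
  have "b > 0" using \<open>b1 < b2\<close> by (simp add: b_def)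
  define d where "d r = \<phi>2 r - \<phi>1 r" for r
  define e where "e r = \<psi>2 r - \<psi>1 r" for r
  have flux: "flux d (\<lambda>r. p2 r - p1 r) e r"
    "flux e (\<lambda>r. P2 r - P1 r) (\<lambda>r. \<phi>2 r powr q - \<phi>1 r powr q) r"
    if "r > 0" for r
    using sol [OF that] by (auto simp: solves_def d_def [abs_def] e_def [abs_def] intro: flux_diff)
  have d0: "(d \<longlongrightarrow> 0) (at_right 0)"
    using tendsto_diff [OF \<phi>(2,1)] by (simp add: d_def [abs_def])
  have e0: "(e \<longlongrightarrow> b) (at_right 0)"
    using tendsto_diff [OF \<psi>(2,1)] by (simp add: e_def [abs_def] b_def)
  \<comment> \<open>The two halves of the feedback loop between the differences \<open>d\<close> and \<open>e\<close>.\<close>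
  have e_ge: "e r \<ge> b" if "r > 0" and nonneg: "\<And>y. 0 < y \<Longrightarrow> y \<le> r \<Longrightarrow> d y \<ge> 0" for r
  proof -
    have "\<phi>2 y powr q - \<phi>1 y powr q \<ge> 0" if "0 < y" "y \<le> r" for y
      using nonneg [OF that] pos [OF that(1)] q_gt_1 by (auto simp: d_def intro!: powr_mono2)
    then show ?thesis
      using flux_ge(2) [OF \<open>r > 0\<close> flux(2) _ e0, of 0] by simp
  qed
  have d_pos: "d r > 0" if G: "G > 0" and "r > 0" and "\<And>y. 0 < y \<Longrightarrow> y \<le> r \<Longrightarrow> e y \<ge> G" for r G
  proof -
    have "0 < G / ((n - \<alpha>) * \<gamma>) * r powr \<gamma>"
      using G \<open>r > 0\<close> n\<alpha>_pos \<gamma>_pos by simp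
    also have "\<dots> \<le> d r"
      using flux_ge(2) [OF \<open>r > 0\<close> flux(1) _ d0, of G] that by simp
    finally show ?thesis .
  qed
  have "\<forall>\<^sub>F r in at_right 0. e r > b / 2"
    using e0 \<open>b > 0\<close> by (intro order_tendstoD(1)) auto
  then obtain s where "s > 0" and s: "\<And>r. 0 < r \<Longrightarrow> r < s \<Longrightarrow> e r > b / 2"
    by (auto simp: eventually_at_right_field)
  have d: "d r > 0" if "r > 0" for r
  proof (rule positive_by_continuation [OF \<open>s > 0\<close> _ _ _ that])
    fix x assume "0 < x" "x < s"
    then show "d x > 0"
      using d_pos [of "b / 2" x] s \<open>b > 0\<close> by (simp add: less_imp_le)
  next
    fix x assume "0 < x" "\<And>y. 0 < y \<Longrightarrow> y \<le> x \<Longrightarrow> d y \<ge> 0"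
    then show "d x > 0"
      using d_pos [OF \<open>b > 0\<close>, of x] e_ge by simp
  qed (use flux(1) flux_isCont in blast)
  have e: "e r \<ge> b" if "r > 0" for r
    using e_ge [OF that] d by (simp add: less_imp_le)
  show "\<psi>2 R \<ge> \<psi>1 R + (b2 - b1)"
    using e [OF \<open>R > 0\<close>] by (simp add: e_def b_def)
  show "p2 R \<ge> p1 R + (b2 - b1) / (n - \<alpha>) * R powr (n - \<alpha>)"
    using flux_ge(1) [OF \<open>R > 0\<close> flux(1) _ d0, of b] e by (simp add: b_def)
  show "\<phi>2 R \<ge> \<phi>1 R + (b2 - b1) / ((n - \<alpha>) * \<gamma>) * R powr \<gamma>"
    using flux_ge(2) [OF \<open>R > 0\<close> flux(1) _ d0, of b] e by (simp add: b_def d_def)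
qed

section \<open>Uniqueness of the initial value problem at the origin\<close>

lemma powr_lipschitz:
  assumes "0 < x" "x \<le> B" "0 < y" "y \<le> B"
  shows "\<bar>x powr q - y powr q\<bar> \<le> q * B powr (q - 1) * \<bar>x - y\<bar>"
proof -
  have *: "\<bar>x powr q - y powr q\<bar> \<le> q * B powr (q - 1) * \<bar>x - y\<bar>"
    if "0 < x" "x < y" "y \<le> B" for x y
  proof -
    have "\<exists>z. x < z \<and> z < y \<and> y powr q - x powr q = (y - x) * (q * z powr (q - 1))"
      using that by (intro MVT2) (auto intro!: derivative_eq_intros)
    then obtain z where z: "x < z" "z < y" "y powr q - x powr q = (y - x) * (q * z powr (q - 1))"
      by blast
    have "(y - x) * (q * z powr (q - 1)) \<le> (y - x) * (q * B powr (q - 1))"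
      using z that q_gt_1 by (intro mult_left_mono powr_mono2) auto
    moreover have "0 \<le> (y - x) * (q * z powr (q - 1))"
      using z q_gt_1 by simp
    ultimately have "\<bar>y powr q - x powr q\<bar> \<le> (y - x) * (q * B powr (q - 1))"
      using z(3) by simp
    then show ?thesis
      using that by (simp add: abs_minus_commute mult_ac)
  qed
  show ?thesis
    using *[of x y] *[of y x] assms
    by (cases x y rule: linorder_cases) (auto simp: abs_minus_commute)
qed

lemma bounded_up_to_origin:
  fixes f :: "real \<Rightarrow> real"
  assumes "(f \<longlongrightarrow> l) (at_right 0)" "\<And>r. r > 0 \<Longrightarrow> isCont f r"
  shows "\<exists>B. \<forall>r. 0 < r \<and> r \<le> T \<longrightarrow> \<bar>f r\<bar> \<le> B"
proof -
  have "\<forall>\<^sub>F r in at_right 0. \<bar>f r\<bar> < \<bar>l\<bar> + 1"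
    using tendsto_rabs [OF assms(1)] by (intro order_tendstoD(2)) auto
  then obtain s where "s > 0" and s: "\<And>r. 0 < r \<Longrightarrow> r < s \<Longrightarrow> \<bar>f r\<bar> < \<bar>l\<bar> + 1"
    by (auto simp: eventually_at_right_field)
  have "compact (f ` {s..T})"
    using \<open>s > 0\<close> assms(2) by (intro compact_continuous_image continuous_at_imp_continuous_on) auto
  then have "bounded (f ` {s..T})" by (rule compact_imp_bounded)
  then obtain B where B: "\<forall>r\<in>{s..T}. \<bar>f r\<bar> \<le> B"
    by (auto simp: bounded_iff)
  show ?thesis
  proof (intro exI allI impI)
    fix r assume "0 < r \<and> r \<le> T"
    then show "\<bar>f r\<bar> \<le> max B (\<bar>l\<bar> + 1)"
      using s [of r] B by (cases "r < s") (auto simp: le_max_iff_disj)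
  qed
qed

text \<open>The singularity at the origin puts this outside the scope of the usual theorems on initial value
  problems. Iterating \<open>flux_exp_bound\<close> halves the weighted distance of the two solutions in each step.\<close>

lemma solution_determined_at_origin:
  assumes sol: "\<And>r. r > 0 \<Longrightarrow> solves \<phi>1 p1 \<psi>1 P1 r" "\<And>r. r > 0 \<Longrightarrow> solves \<phi>2 p2 \<psi>2 P2 r"
    and pos: "\<And>r. r > 0 \<Longrightarrow> \<phi>1 r > 0" "\<And>r. r > 0 \<Longrightarrow> \<phi>2 r > 0"
    and \<phi>: "(\<phi>1 \<longlongrightarrow> c) (at_right 0)" "(\<phi>2 \<longlongrightarrow> c) (at_right 0)"
    and \<psi>: "(\<psi>1 \<longlongrightarrow> b) (at_right 0)" "(\<psi>2 \<longlongrightarrow> b) (at_right 0)"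
    and "T > 0"
  shows "\<phi>1 T = \<phi>2 T"
proof -
  define d where "d r = \<phi>1 r - \<phi>2 r" for r
  define e where "e r = \<psi>1 r - \<psi>2 r" for r
  have flux: "flux d (\<lambda>r. p1 r - p2 r) e r"
    "flux e (\<lambda>r. P1 r - P2 r) (\<lambda>r. \<phi>1 r powr q - \<phi>2 r powr q) r"
    if "r > 0" for r
    using sol [OF that] by (auto simp: solves_def d_def [abs_def] e_def [abs_def] intro: flux_diff)
  have d0: "(d \<longlongrightarrow> 0) (at_right 0)"
    using tendsto_diff [OF \<phi>] by (simp add: d_def [abs_def])
  have e0: "(e \<longlongrightarrow> 0) (at_right 0)"
    using tendsto_diff [OF \<psi>] by (simp add: e_def [abs_def])
  have cont: "isCont \<phi>1 r" "isCont \<phi>2 r" "isCont d r" "isCont e r" if "r > 0" for r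
    using sol [OF that] flux [OF that] by (auto simp: solves_def intro: flux_isCont)
  obtain B1 B2 where B12: "\<And>r. 0 < r \<Longrightarrow> r \<le> T \<Longrightarrow> \<bar>\<phi>1 r\<bar> \<le> B1"
    "\<And>r. 0 < r \<Longrightarrow> r \<le> T \<Longrightarrow> \<bar>\<phi>2 r\<bar> \<le> B2"
    using bounded_up_to_origin [OF \<phi>(1) cont(1), of T]
      bounded_up_to_origin [OF \<phi>(2) cont(2), of T] by auto
  obtain D E where DE: "\<And>r. 0 < r \<Longrightarrow> r \<le> T \<Longrightarrow> \<bar>d r\<bar> \<le> D" "\<And>r. 0 < r \<Longrightarrow> r \<le> T \<Longrightarrow> \<bar>e r\<bar> \<le> E"
    using bounded_up_to_origin [OF d0 cont(3), of T] bounded_up_to_origin [OF e0 cont(4), of T] by auto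
  define B where "B = max B1 B2"
  define L where "L = q * B powr (q - 1)"
  have "L \<ge> 0" using q_gt_1 by (simp add: L_def)
  have lip: "\<bar>\<phi>1 r powr q - \<phi>2 r powr q\<bar> \<le> L * \<bar>d r\<bar>" if "0 < r" "r \<le> T" for r
    unfolding L_def d_def using that pos [OF that(1)] B12 [of r]
    by (intro powr_lipschitz) (auto simp: B_def)
  \<comment> \<open>Large enough to halve the error in either equation, the second of which costs the Lipschitz constant \<open>L\<close>.\<close>
  define K where "K = 2 * (1 + L) / (\<gamma> * (n - \<alpha>))"
  have K: "K > 0" "K * \<gamma> * (n - \<alpha>) = 2 * (1 + L)"
    using \<open>L \<ge> 0\<close> \<gamma>_pos n\<alpha>_pos by (auto simp: K_def)
  define A where "A = max D E"
  have "A \<ge> 0" using DE(1) [of T] \<open>T > 0\<close> by (auto simp: A_def)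
  have bound: "\<bar>d r\<bar> \<le> A / 2 ^ j * exp (K * r powr \<gamma>) \<and> \<bar>e r\<bar> \<le> A / 2 ^ j * exp (K * r powr \<gamma>)"
    if "0 < r" "r \<le> T" for r j
    using that
  proof (induction j arbitrary: r)
    case 0
    have "A \<le> A * exp (K * r powr \<gamma>)"
      using \<open>A \<ge> 0\<close> K(1) by (simp add: mult_le_cancel_left1)
    then show ?case
      using DE [OF 0] by (auto simp: A_def)
  next
    case (Suc j)
    define a where "a = A / 2 ^ j"
    have "a \<ge> 0" using \<open>A \<ge> 0\<close> by (simp add: a_def)
    have IH: "\<bar>d s\<bar> \<le> a * exp (K * s powr \<gamma>)" "\<bar>e s\<bar> \<le> a * exp (K * s powr \<gamma>)"
      if "0 < s" "s \<le> r" for s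
      using Suc.IH [of s] Suc.prems that by (auto simp: a_def)
    have "\<bar>d r\<bar> \<le> a / (2 * (1 + L)) * exp (K * r powr \<gamma>)"
      using flux_exp_bound [OF \<open>0 < r\<close> K(1) \<open>a \<ge> 0\<close> flux(1) IH(2) d0] K(2) by simp
    also have "\<dots> \<le> a / 2 * exp (K * r powr \<gamma>)"
      using \<open>L \<ge> 0\<close> \<open>a \<ge> 0\<close> by (intro mult_right_mono divide_left_mono) auto
    finally have 1: "\<bar>d r\<bar> \<le> a / 2 * exp (K * r powr \<gamma>)" .
    have "\<bar>\<phi>1 s powr q - \<phi>2 s powr q\<bar> \<le> L * a * exp (K * s powr \<gamma>)" if "0 < s" "s \<le> r" for s
    proof -
      have "\<bar>\<phi>1 s powr q - \<phi>2 s powr q\<bar> \<le> L * \<bar>d s\<bar>"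
        using lip [of s] that Suc.prems by simp
      also have "\<dots> \<le> L * (a * exp (K * s powr \<gamma>))"
        using IH(1) [OF that] \<open>L \<ge> 0\<close> by (rule mult_left_mono)
      finally show ?thesis by (simp add: mult.assoc)
    qed
    then have "\<bar>e r\<bar> \<le> L * a / (2 * (1 + L)) * exp (K * r powr \<gamma>)"
      using flux_exp_bound [OF \<open>0 < r\<close> K(1) _ flux(2) _ e0, of "L * a"] K(2) \<open>a \<ge> 0\<close> \<open>L \<ge> 0\<close> by simp
    also have "\<dots> \<le> a / 2 * exp (K * r powr \<gamma>)"
      using \<open>L \<ge> 0\<close> \<open>a \<ge> 0\<close> by (intro mult_right_mono) (auto simp: field_simps)
    finally show ?case
      using 1 by (simp add: a_def field_simps)
  qed
  have "(\<lambda>j. A * exp (K * T powr \<gamma>) * (1 / 2) ^ j) \<longlonglongrightarrow> 0"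
    using tendsto_mult [OF tendsto_const LIMSEQ_power_zero [of "1 / 2 :: real"]] by simp
  then have "\<bar>d T\<bar> \<le> 0"
    by (rule tendsto_lowerbound)
      (use bound [OF \<open>T > 0\<close> order_refl] in \<open>auto simp: field_simps power_divide\<close>)
  then show ?thesis by (simp add: d_def)
qed

section \<open>The explicit solutions\<close>

text \<open>The decay exponent, with \<open>m \<gamma> = n - 4 + \<alpha>\<close> and \<open>m q = m + 4\<close>.\<close>

definition "m = (n - 4 + \<alpha>) / (2 - \<alpha>)"

text \<open>The number whose power is the constant of the bubble; it arises as the product of the factors
  that four differentiations of the profile produce.\<close>

definition "bubble_factor = (n - 4 + \<alpha>) * (n - 2) * (n - \<alpha>) * (n + 2 - 2 * \<alpha>)"

text \<open>Chosen such that \<open>A\<^sup>q = A bubble_factor \<kappa>\<^sup>2\<close>, which balances the two sides of the equation.\<close>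

definition "amplitude \<kappa> = bubble_factor powr (m / 4) * \<bar>\<kappa>\<bar> powr (m / 2)"

definition "base \<kappa> r = 1 + \<kappa> * r powr \<gamma>"

definition "profile \<kappa> r = amplitude \<kappa> * base \<kappa> r powr (- m)"

definition "profile_flux \<kappa> r = - (amplitude \<kappa> * m * \<kappa> * \<gamma>) * (r powr (n - \<alpha>) * base \<kappa> r powr (- m - 1))"

definition "profile_lap \<kappa> r =
  - (amplitude \<kappa> * m * \<kappa> * \<gamma>) * ((n - 2) * base \<kappa> r powr (- m - 2) + \<gamma> * base \<kappa> r powr (- m - 1))"

definition "profile_lap_flux \<kappa> r = amplitude \<kappa> * m * \<kappa>\<^sup>2 * \<gamma>\<^sup>2 * (n - 2) *
  (r powr (n - \<alpha>) * ((m + 2) * base \<kappa> r powr (- m - 3) + base \<kappa> r powr (- m - 2)))"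

lemma m_pos: "m > 0"
  using \<alpha>_lt \<alpha>_gt by (simp add: m_def)

lemma m_\<gamma>: "m * \<gamma> = n - 4 + \<alpha>"
  using \<alpha>_lt by (simp add: m_def \<gamma>_def)

lemma bubble_factor_pos: "bubble_factor > 0"
  using n_gt \<alpha>_lt \<alpha>_gt by (simp add: bubble_factor_def)

lemma bubble_factor_eq: "bubble_factor = m * \<gamma>\<^sup>2 * (n - 2) * (n - \<alpha>) * (m + 3)"
proof -
  have "n + 2 - 2 * \<alpha> = \<gamma> * (m + 3)"
    using m_\<gamma> by (simp add: \<gamma>_def algebra_simps)
  then show ?thesis
    unfolding bubble_factor_def m_\<gamma> [symmetric] by (simp add: power2_eq_square)
qed

lemma m_q: "m * q = m + 4"
proof -
  have "m * q = (n + 4 - 3 * \<alpha>) / (2 - \<alpha>)"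
    using \<alpha>_gt by (simp add: m_def q_def)
  also have "\<dots> = m + 4"
    using \<alpha>_lt by (simp add: m_def field_simps)
  finally show ?thesis .
qed

lemma amplitude_pos: "\<kappa> \<noteq> 0 \<Longrightarrow> amplitude \<kappa> > 0"
  using bubble_factor_pos by (simp add: amplitude_def)

lemma amplitude_powr_q:
  assumes "\<kappa> \<noteq> 0"
  shows "amplitude \<kappa> powr q = amplitude \<kappa> * bubble_factor * \<kappa>\<^sup>2"
proof -
  have *: "m * q / 4 = m / 4 + 1" "m * q / 2 = m / 2 + 2"
    using m_q by (auto simp: field_simps)
  have "\<bar>\<kappa>\<bar> powr 2 = \<kappa>\<^sup>2"
    using powr_realpow [of "\<bar>\<kappa>\<bar>" 2] assms by simp
  then show ?thesis
    unfolding amplitude_def using bubble_factor_pos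
    by (simp add: powr_mult powr_powr * powr_add)
qed

lemma base_powr_deriv:
  assumes "r > 0" "base \<kappa> r > 0"
  shows "((\<lambda>r. base \<kappa> r powr a) has_real_derivative
            a * \<kappa> * \<gamma> * (r powr (1 - n) * r powr (n - \<alpha>)) * base \<kappa> r powr (a - 1)) (at r)"
proof -
  have "r powr (\<gamma> - 1) = r powr (1 - n) * r powr (n - \<alpha>)"
    by (simp add: \<gamma>_def flip: powr_add)
  then show ?thesis
    using assms unfolding base_def
    by (auto intro!: derivative_eq_intros simp: base_def)
qed

text \<open>Writing \<open>\<kappa> r\<^sup>\<gamma> = base - 1\<close> turns the weighted derivative into a combination of two
  powers of the base, so that no powers of \<open>r\<close> accumulate under repeated differentiation.\<close>

lemma base_powr_weighted_deriv:
  assumes "r > 0" "base \<kappa> r > 0"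
  shows "((\<lambda>r. r powr (n - \<alpha>) * base \<kappa> r powr a) has_real_derivative
      r powr (n - 1 - \<alpha>) * ((n - \<alpha> + a * \<gamma>) * base \<kappa> r powr a - a * \<gamma> * base \<kappa> r powr (a - 1))) (at r)"
proof -
  have 1: "r powr (n - \<alpha>) * (r powr (1 - n) * r powr (n - \<alpha>)) = r powr (n - 1 - \<alpha>) * r powr \<gamma>"
    by (simp add: \<gamma>_def algebra_simps flip: powr_add)
  have 2: "base \<kappa> r powr a = base \<kappa> r powr (a - 1) * (1 + \<kappa> * r powr \<gamma>)"
    using assms powr_add [of "base \<kappa> r" "a - 1" 1] by (simp add: base_def)
  have "((\<lambda>r. r powr (n - \<alpha>)) has_real_derivative (n - \<alpha>) * r powr (n - 1 - \<alpha>)) (at r)"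
    using assms(1) n\<alpha>_pos by (auto intro!: derivative_eq_intros simp: algebra_simps)
  from DERIV_mult [OF this base_powr_deriv [OF assms, of a]]
  have "((\<lambda>r. r powr (n - \<alpha>) * base \<kappa> r powr a) has_real_derivative
      (n - \<alpha>) * r powr (n - 1 - \<alpha>) * base \<kappa> r powr a +
      a * \<kappa> * \<gamma> * (r powr (1 - n) * r powr (n - \<alpha>)) * base \<kappa> r powr (a - 1) * r powr (n - \<alpha>)) (at r)"
    .
  also have "a * \<kappa> * \<gamma> * (r powr (1 - n) * r powr (n - \<alpha>)) * base \<kappa> r powr (a - 1) * r powr (n - \<alpha>)
     = a * \<kappa> * \<gamma> * base \<kappa> r powr (a - 1) * (r powr (n - 1 - \<alpha>) * r powr \<gamma>)"
    unfolding 1 [symmetric] by simp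
  also have "(n - \<alpha>) * r powr (n - 1 - \<alpha>) * base \<kappa> r powr a + \<dots> =
     r powr (n - 1 - \<alpha>) * ((n - \<alpha> + a * \<gamma>) * base \<kappa> r powr a - a * \<gamma> * base \<kappa> r powr (a - 1))"
    unfolding 2 by (simp add: algebra_simps)
  finally show ?thesis .
qed

text \<open>Each differentiation is one of the two preceding rules. In the last one the powers \<open>- m - 2\<close> and \<open>- m - 3\<close>
  of the base cancel because of \<open>n - \<alpha> = (m + 2) \<gamma>\<close>, and the remaining power \<open>- m - 4 = - m q\<close> is that of
  the nonlinearity. The sign of \<open>\<kappa>\<close> is left open: negative values give blow-up profiles.\<close>

lemma profile_solves:
  assumes "r > 0" "base \<kappa> r > 0" "\<kappa> \<noteq> 0"
  shows "solves (profile \<kappa>) (profile_flux \<kappa>) (profile_lap \<kappa>) (profile_lap_flux \<kappa>) r"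
proof -
  define A where "A = amplitude \<kappa>"
  define X where "X a = base \<kappa> r powr a" for a
  have e: "- m - 1 - 1 = - m - 2" "- m - 2 - 1 = - m - 3" "- m - 3 - 1 = - m - 4"
    by simp_all
  note d = base_powr_deriv [OF assms(1,2), folded X_def]
  note w = base_powr_weighted_deriv [OF assms(1,2), folded X_def]
  have "(profile \<kappa> has_real_derivative r powr (1 - n) * profile_flux \<kappa> r) (at r)"
    using DERIV_cmult [OF d [of "- m"], of A]
    by (simp add: profile_def [abs_def] profile_flux_def A_def X_def mult_ac)
  moreover have "(profile_flux \<kappa> has_real_derivative r powr (n - 1 - \<alpha>) * profile_lap \<kappa> r) (at r)"
  proof -
    have *: "n - \<alpha> + (- m - 1) * \<gamma> = \<gamma>" "(- m - 1) * \<gamma> = - (n - 2)"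
      using m_\<gamma> by (simp_all add: \<gamma>_def algebra_simps)
    have "((\<lambda>r. r powr (n - \<alpha>) * base \<kappa> r powr (- m - 1)) has_real_derivative
        r powr (n - 1 - \<alpha>) * ((n - 2) * X (- m - 2) + \<gamma> * X (- m - 1))) (at r)"
      using w [of "- m - 1"] unfolding e unfolding *(1) unfolding *(2) minus_mult_left [symmetric] diff_minus_eq_add
      by (simp only: add.commute)
    from DERIV_cmult [OF this, of "- (A * m * \<kappa> * \<gamma>)"] show ?thesis
      by (simp add: profile_lap_def profile_flux_def [abs_def] A_def X_def mult_ac)
  qed
  moreover have "(profile_lap \<kappa> has_real_derivative r powr (1 - n) * profile_lap_flux \<kappa> r) (at r)"
  proof -
    have g: "(m + 1) * \<gamma> = n - 2"
      using m_\<gamma> by (simp add: \<gamma>_def algebra_simps)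
    have "((\<lambda>r. (n - 2) * base \<kappa> r powr (- m - 2) + \<gamma> * base \<kappa> r powr (- m - 1)) has_real_derivative
      (n - 2) * ((- m - 2) * \<kappa> * \<gamma> * (r powr (1 - n) * r powr (n - \<alpha>)) * X (- m - 3)) +
      \<gamma> * ((- m - 1) * \<kappa> * \<gamma> * (r powr (1 - n) * r powr (n - \<alpha>)) * X (- m - 2))) (at r)"
      using DERIV_add [OF DERIV_cmult [OF d [of "- m - 2"], of "n - 2"]
          DERIV_cmult [OF d [of "- m - 1"], of \<gamma>]]
      unfolding e by simp
    moreover have "(n - 2) * ((- m - 2) * \<kappa> * \<gamma> * (r powr (1 - n) * r powr (n - \<alpha>)) * X (- m - 3)) +
      \<gamma> * ((- m - 1) * \<kappa> * \<gamma> * (r powr (1 - n) * r powr (n - \<alpha>)) * X (- m - 2))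
      = - (r powr (1 - n) * (\<kappa> * \<gamma> * (n - 2) * (r powr (n - \<alpha>) * ((m + 2) * X (- m - 3) + X (- m - 2)))))"
      unfolding g [symmetric] by (simp add: algebra_simps)
    ultimately have "((\<lambda>r. (n - 2) * base \<kappa> r powr (- m - 2) + \<gamma> * base \<kappa> r powr (- m - 1)) has_real_derivative
      - (r powr (1 - n) * (\<kappa> * \<gamma> * (n - 2) * (r powr (n - \<alpha>) * ((m + 2) * X (- m - 3) + X (- m - 2)))))) (at r)"
      by simp
    from DERIV_cmult [OF this, of "- (A * m * \<kappa> * \<gamma>)"] show ?thesis
      by (simp add: profile_lap_def [abs_def] profile_lap_flux_def A_def X_def mult_ac power2_eq_square)
  qed
  moreover have "(profile_lap_flux \<kappa> has_real_derivative r powr (n - 1 - \<alpha>) * profile \<kappa> r powr q) (at r)"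
  proof -
    define W where "W a = (n - \<alpha> + a * \<gamma>) * X a - a * \<gamma> * X (a - 1)" for a
    have W: "(m + 2) * W (- m - 3) + W (- m - 2) = (n - \<alpha>) * (m + 3) * X (- m - 4)"
    proof -
      have *: "n - \<alpha> = (m + 2) * \<gamma>"
        using m_\<gamma> by (simp add: \<gamma>_def algebra_simps)
      show ?thesis
        unfolding W_def e * by (simp add: algebra_simps)
    qed
    have "((\<lambda>r. (m + 2) * (r powr (n - \<alpha>) * base \<kappa> r powr (- m - 3)) +
          r powr (n - \<alpha>) * base \<kappa> r powr (- m - 2)) has_real_derivative
      (m + 2) * (r powr (n - 1 - \<alpha>) * W (- m - 3)) + r powr (n - 1 - \<alpha>) * W (- m - 2)) (at r)"
      unfolding W_def by (intro DERIV_add DERIV_cmult w)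
    moreover have "(m + 2) * (r powr (n - 1 - \<alpha>) * W (- m - 3)) + r powr (n - 1 - \<alpha>) * W (- m - 2)
        = r powr (n - 1 - \<alpha>) * ((n - \<alpha>) * (m + 3) * X (- m - 4))"
      unfolding W [symmetric] by (simp add: algebra_simps)
    ultimately have "((\<lambda>r. (m + 2) * (r powr (n - \<alpha>) * base \<kappa> r powr (- m - 3)) +
          r powr (n - \<alpha>) * base \<kappa> r powr (- m - 2)) has_real_derivative
          r powr (n - 1 - \<alpha>) * ((n - \<alpha>) * (m + 3) * X (- m - 4))) (at r)"
      by simp
    from DERIV_cmult [OF this, of "A * m * \<kappa>\<^sup>2 * \<gamma>\<^sup>2 * (n - 2)"]
    have "(profile_lap_flux \<kappa> has_real_derivative
        A * m * \<kappa>\<^sup>2 * \<gamma>\<^sup>2 * (n - 2) * (r powr (n - 1 - \<alpha>) * ((n - \<alpha>) * (m + 3) * X (- m - 4)))) (at r)"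
      by (simp add: profile_lap_flux_def [abs_def] A_def distrib_left mult_ac)
    also have "A * m * \<kappa>\<^sup>2 * \<gamma>\<^sup>2 * (n - 2) * (r powr (n - 1 - \<alpha>) * ((n - \<alpha>) * (m + 3) * X (- m - 4)))
        = r powr (n - 1 - \<alpha>) * (A * bubble_factor * \<kappa>\<^sup>2 * X (- m - 4))"
      unfolding bubble_factor_eq by (simp only: mult_ac)
    finally have "(profile_lap_flux \<kappa> has_real_derivative
        r powr (n - 1 - \<alpha>) * (A * bubble_factor * \<kappa>\<^sup>2 * X (- m - 4))) (at r)" .
    moreover have "profile \<kappa> r powr q = A * bubble_factor * \<kappa>\<^sup>2 * X (- m - 4)"
    proof -
      have "- m * q = - m - 4" using m_q by simp
      then show ?thesis
        using assms amplitude_pos [of \<kappa>] amplitude_powr_q [of \<kappa>]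
        by (simp add: profile_def powr_mult powr_powr A_def X_def)
    qed
    ultimately show ?thesis by simp
  qed
  ultimately show ?thesis
    by (simp add: solves_def flux_def)
qed

lemma tendsto_base_powr:
  "((\<lambda>r. base \<kappa> r powr a) \<longlongrightarrow> 1) (at_right 0)"
proof -
  have "(base \<kappa> \<longlongrightarrow> 1) (at_right 0)"
    using tendsto_add [OF tendsto_const tendsto_mult [OF tendsto_const tendsto_powr_zero [OF \<gamma>_pos]], of 1 \<kappa>]
    by (simp add: base_def [abs_def])
  from tendsto_powr [OF this tendsto_const, of a] show ?thesis by simp
qed

lemma profile_at_origin:
  "(profile \<kappa> \<longlongrightarrow> amplitude \<kappa>) (at_right 0)"
  "(profile_lap \<kappa> \<longlongrightarrow> - (amplitude \<kappa> * m * \<kappa> * \<gamma>) * (n - 2 + \<gamma>)) (at_right 0)"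
  unfolding profile_def [abs_def] profile_lap_def [abs_def]
  using tendsto_mult [OF tendsto_const tendsto_base_powr, of "amplitude \<kappa>" \<kappa> "- m"]
    tendsto_mult [OF tendsto_const tendsto_add [OF tendsto_mult [OF tendsto_const tendsto_base_powr]
        tendsto_mult [OF tendsto_const tendsto_base_powr]],
      of "- (amplitude \<kappa> * m * \<kappa> * \<gamma>)" "n - 2" \<kappa> "- m - 2" \<gamma> \<kappa> "- m - 1"]
  by simp_all

section \<open>Blow-up\<close>

text \<open>As \<open>\<mu>\<close> decreases to \<open>0\<close>, the profile for \<open>\<kappa> = - \<mu>\<close> and its fluxes at the fixed radius \<open>a\<close> tend to \<open>0\<close>, while the profile
  still blows up at a finite radius \<open>R > a\<close>. For small \<open>\<mu>\<close> it starts below the solution at \<open>a\<close>, so it stays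
  below on the interval up to \<open>R\<close>, although the solution is continuous at \<open>R\<close>.\<close>

lemma no_growing_solution:
  assumes sol: "\<And>r. r > 0 \<Longrightarrow> solves \<phi> p \<psi> P r"
    and "a > 0" "\<phi> a > 0" "p a > 0" "\<psi> a > 0" "P a > 0"
  shows False
proof -
  have A0: "((\<lambda>\<mu>. amplitude (- \<mu>)) \<longlongrightarrow> 0) (at_right 0)"
  proof -
    have "((\<lambda>\<mu>. \<bar>- \<mu>\<bar> powr (m / 2)) \<longlongrightarrow> 0) (at_right (0::real))"
      by (rule tendsto_zero_powrI [where b = "m / 2"])
        (use m_pos in \<open>auto intro!: tendsto_eq_intros\<close>)
    from tendsto_mult [OF tendsto_const this] show ?thesis
      by (simp add: amplitude_def [abs_def])
  qed
  have B1: "((\<lambda>\<mu>. base (- \<mu>) a powr s) \<longlongrightarrow> 1) (at_right 0)" for s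
  proof -
    have "((\<lambda>\<mu>. base (- \<mu>) a) \<longlongrightarrow> 1) (at_right 0)"
      unfolding base_def by (auto intro!: tendsto_eq_intros)
    from tendsto_powr [OF this tendsto_const, of s] show ?thesis by simp
  qed
  have M0: "((\<lambda>\<mu>. - \<mu>) \<longlongrightarrow> 0) (at_right (0::real))"
    by (auto intro!: tendsto_eq_intros)
  have lim: "((\<lambda>\<mu>. profile (- \<mu>) a) \<longlongrightarrow> 0) (at_right 0)"
    "((\<lambda>\<mu>. profile_flux (- \<mu>) a) \<longlongrightarrow> 0) (at_right 0)"
    "((\<lambda>\<mu>. profile_lap (- \<mu>) a) \<longlongrightarrow> 0) (at_right 0)"
    "((\<lambda>\<mu>. profile_lap_flux (- \<mu>) a) \<longlongrightarrow> 0) (at_right 0)"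
    unfolding profile_def profile_flux_def profile_lap_def profile_lap_flux_def
    by (rule tendsto_eq_rhs, (rule tendsto_intros A0 B1 M0)+, simp)+
  have "\<forall>\<^sub>F \<mu> in at_right 0. 0 < \<mu> \<and> \<mu> < a powr (- \<gamma>)
       \<and> profile (- \<mu>) a < \<phi> a \<and> profile_flux (- \<mu>) a < p a
       \<and> profile_lap (- \<mu>) a < \<psi> a \<and> profile_lap_flux (- \<mu>) a < P a"
    using assms lim by (intro eventually_conj order_tendstoD(2) [where y = 0])
      (auto intro!: eventually_at_right_less order_tendstoD(2) [where y = 0] tendsto_ident_at)
  then obtain \<mu> where \<mu>: "0 < \<mu>" "\<mu> < a powr (- \<gamma>)" "profile (- \<mu>) a < \<phi> a" "profile_flux (- \<mu>) a < p a"
    "profile_lap (- \<mu>) a < \<psi> a" "profile_lap_flux (- \<mu>) a < P a"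
    using eventually_happens'[OF trivial_limit_at_right_real] by blast
  define R where "R = (1 / \<mu>) powr (1 / \<gamma>)"
  have "R > 0" using \<mu>(1) by (simp add: R_def)
  have R: "base (- \<mu>) R = 0"
    using \<mu>(1) \<gamma>_pos by (simp add: base_def R_def powr_powr)
  have base_pos: "base (- \<mu>) r > 0" if "0 < r" "r < R" for r
  proof -
    have "\<mu> * r powr \<gamma> < \<mu> * R powr \<gamma>"
      using that \<mu>(1) \<gamma>_pos by (intro mult_strict_left_mono powr_less_mono2) auto
    then show ?thesis using R by (simp add: base_def)
  qed
  have "a < R"
  proof (rule ccontr)
    assume "\<not> a < R"
    then have "\<mu> * R powr \<gamma> \<le> \<mu> * a powr \<gamma>"
      using \<mu>(1) \<gamma>_pos \<open>R > 0\<close> by (intro mult_left_mono powr_mono2) auto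
    also have "\<dots> < a powr (- \<gamma>) * a powr \<gamma>"
      using \<mu>(2) \<open>a > 0\<close> by (intro mult_strict_right_mono) auto
    also have "\<dots> = 1" using \<open>a > 0\<close> by (simp flip: powr_add)
    finally show False using R by (simp add: base_def)
  qed
  have profile_pos: "profile (- \<mu>) r > 0" if "0 < r" "r < R" for r
    using base_pos [OF that] amplitude_pos [of "- \<mu>"] \<mu>(1) by (simp add: profile_def)
  have above: "profile (- \<mu>) r < \<phi> r" if "a \<le> r" "r < R" for r
    by (rule comparison_from_positive_radius [OF \<open>a > 0\<close> that(1) profile_solves sol])
      (use that \<mu> base_pos profile_pos \<open>a > 0\<close> in auto)
  \<comment> \<open>Multiplying \<open>profile < \<phi>\<close> by the vanishing power of the base turns blow-up into a statement on finite limits.\<close>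
  have "amplitude (- \<mu>) \<le> \<phi> R * 0"
  proof (rule tendsto_lowerbound)
    have "isCont \<phi> R"
      using sol [OF \<open>R > 0\<close>] by (auto simp: solves_def intro: flux_isCont)
    moreover have "((\<lambda>r. base (- \<mu>) r powr m) \<longlongrightarrow> 0) (at_left R)"
    proof (rule tendsto_zero_powrI [OF _ tendsto_const _ m_pos])
      have "isCont (base (- \<mu>)) R"
        unfolding base_def [abs_def] using \<open>R > 0\<close> by (auto intro!: continuous_intros)
      then show "(base (- \<mu>) \<longlongrightarrow> 0) (at_left R)"
        using R by (simp add: isCont_def filterlim_at_split)
      show "\<forall>\<^sub>F r in at_left R. 0 \<le> base (- \<mu>) r"
        using base_pos \<open>R > 0\<close> by (auto intro!: eventually_at_leftI [of 0] less_imp_le)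
    qed
    ultimately show "((\<lambda>r. \<phi> r * base (- \<mu>) r powr m) \<longlongrightarrow> \<phi> R * 0) (at_left R)"
      by (intro tendsto_mult) (auto simp: isCont_def filterlim_at_split)
    show "\<forall>\<^sub>F r in at_left R. amplitude (- \<mu>) \<le> \<phi> r * base (- \<mu>) r powr m"
    proof (rule eventually_at_leftI [OF _ \<open>a < R\<close>])
      fix r assume r: "r \<in> {a<..<R}"
      then have "base (- \<mu>) r > 0" using base_pos \<open>a > 0\<close> by auto
      then have "amplitude (- \<mu>) = profile (- \<mu>) r * base (- \<mu>) r powr m"
        by (simp add: profile_def powr_minus)
      also have "\<dots> \<le> \<phi> r * base (- \<mu>) r powr m"
        using above [of r] r by (intro mult_right_mono) auto
      finally show "amplitude (- \<mu>) \<le> \<phi> r * base (- \<mu>) r powr m" .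
    qed
  qed simp
  then show False using amplitude_pos [of "- \<mu>"] \<mu>(1) by simp
qed

section \<open>Identification of the positive solutions\<close>

lemma powr_at_top_real:
  assumes "a > 0"
  shows "filterlim (\<lambda>r::real. r powr a) at_top at_top"
proof -
  have "filterlim (\<lambda>r. exp (a * ln r)) at_top at_top"
    by (rule filterlim_compose [OF exp_at_top filterlim_tendsto_pos_mult_at_top [OF tendsto_const assms ln_at_top]])
  moreover have "\<forall>\<^sub>F r in at_top. exp (a * ln r) = r powr a"
    using eventually_gt_at_top [of "0::real"] by eventually_elim (simp add: powr_def)
  ultimately show ?thesis
    by (simp cong: filterlim_cong)
qed

text \<open>The value \<open>b\<close> of the weighted Laplacian at the origin must equal that of the profile: a smaller one is
  excluded by positivity, a larger one by blow-up.\<close>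

lemma positive_solution_eq_profile:
  assumes sol: "\<And>r. r > 0 \<Longrightarrow> solves \<phi> p \<psi> P r"
    and pos: "\<And>r. r > 0 \<Longrightarrow> \<phi> r > 0"
    and "\<kappa> > 0"
    and \<phi>: "(\<phi> \<longlongrightarrow> amplitude \<kappa>) (at_right 0)"
    and \<psi>: "(\<psi> \<longlongrightarrow> b) (at_right 0)"
    and "r > 0"
  shows "\<phi> r = profile \<kappa> r"
proof -
  define A where "A = amplitude \<kappa>"
  define c where "c = A * m * \<kappa> * \<gamma>"
  define b0 where "b0 = - c * (n - 2 + \<gamma>)"
  have A: "A > 0" using amplitude_pos \<open>\<kappa> > 0\<close> by (simp add: A_def)
  have base_pos: "base \<kappa> r \<ge> 1" for r using \<open>\<kappa> > 0\<close> by (simp add: base_def)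
  then have base_pos': "base \<kappa> r > 0" for r using less_le_trans [OF zero_less_one] by blast
  have psol: "solves (profile \<kappa>) (profile_flux \<kappa>) (profile_lap \<kappa>) (profile_lap_flux \<kappa>) r" if "r > 0" for r
    using profile_solves [OF that base_pos'] \<open>\<kappa> > 0\<close> by simp
  have ppos: "profile \<kappa> r > 0" for r
    using A base_pos' [of r] by (simp add: profile_def A_def less_imp_neq [symmetric])
  have p0: "(profile_lap \<kappa> \<longlongrightarrow> b0) (at_right 0)"
    using profile_at_origin(2) by (simp add: b0_def c_def A_def)
  consider "b = b0" | "b < b0" | "b0 < b" by linarith
  then show ?thesis
  proof cases
    case 1
    show ?thesis
      by (rule solution_determined_at_origin [OF sol psol pos ppos \<phi> profile_at_origin(1) \<psi> _ \<open>r > 0\<close>])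
        (use p0 1 in auto)
  next
    case 2
    \<comment> \<open>The radius at which the gap between the two functions has grown to \<open>A\<close>, the maximum of the profile.\<close>
    define s where "s = (A * ((n - \<alpha>) * \<gamma>) / (b0 - b)) powr (1 / \<gamma>)"
    have s: "s > 0" "s powr \<gamma> = A * ((n - \<alpha>) * \<gamma>) / (b0 - b)"
      using A n\<alpha>_pos \<gamma>_pos 2 by (auto simp: s_def powr_powr)
    have "profile \<kappa> s \<ge> \<phi> s + (b0 - b) / ((n - \<alpha>) * \<gamma>) * s powr \<gamma>"
      by (rule comparison_from_origin(3) [OF sol psol pos \<phi> profile_at_origin(1) \<psi> p0 2 s(1)])
    also have "(b0 - b) / ((n - \<alpha>) * \<gamma>) * s powr \<gamma> = A"
      using 2 n\<alpha>_pos \<gamma>_pos by (simp add: s(2))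
    finally have "profile \<kappa> s > A" using pos [OF s(1)] by simp
    moreover have "base \<kappa> s powr (- m) \<le> 1"
      using base_pos [of s] m_pos by (simp add: powr_minus inverse_le_1_iff ge_one_powr_ge_zero)
    ultimately show ?thesis
      using A by (simp add: profile_def A_def mult_le_cancel_left2 not_less [symmetric])
  next
    case 3
    have base_top: "filterlim (base \<kappa>) at_top at_top"
      unfolding base_def [abs_def] using \<open>\<kappa> > 0\<close> \<gamma>_pos
      by (intro filterlim_tendsto_add_at_top [OF tendsto_const]
          filterlim_tendsto_pos_mult_at_top [OF tendsto_const] powr_at_top_real) auto
    have decay: "((\<lambda>r. base \<kappa> r powr (- s)) \<longlongrightarrow> 0) at_top" if "s > 0" for s
      using that by (intro tendsto_neg_powr base_top) auto
    have "((\<lambda>r. (b - b0) / (n - \<alpha>) - c * base \<kappa> r powr (- m - 1)) \<longlongrightarrow> (b - b0) / (n - \<alpha>) - c * 0) at_top"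
      using decay [of "m + 1"] m_pos by (intro tendsto_intros) simp
    then have ev1: "\<forall>\<^sub>F r in at_top. (b - b0) / (n - \<alpha>) - c * base \<kappa> r powr (- m - 1) > 0"
      by (rule order_tendstoD(1)) (use 3 n\<alpha>_pos in simp)
    have "((\<lambda>r. (b - b0) - c * ((n - 2) * base \<kappa> r powr (- m - 2) + \<gamma> * base \<kappa> r powr (- m - 1)))
        \<longlongrightarrow> (b - b0) - c * ((n - 2) * 0 + \<gamma> * 0)) at_top"
      using decay [of "m + 1"] decay [of "m + 2"] m_pos by (intro tendsto_intros) simp_all
    then have ev2: "\<forall>\<^sub>F r in at_top. (b - b0) - c * ((n - 2) * base \<kappa> r powr (- m - 2) + \<gamma> * base \<kappa> r powr (- m - 1)) > 0"
      by (rule order_tendstoD(1)) (use 3 in simp)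
    obtain a where a: "a > 0" "(b - b0) / (n - \<alpha>) - c * base \<kappa> a powr (- m - 1) > 0"
      "(b - b0) - c * ((n - 2) * base \<kappa> a powr (- m - 2) + \<gamma> * base \<kappa> a powr (- m - 1)) > 0"
      using eventually_happens' [OF _ eventually_conj [OF eventually_gt_at_top [of 0]
            eventually_conj [OF ev1 ev2]]] by auto
    note cmp = comparison_from_origin [OF psol sol ppos profile_at_origin(1) \<phi> p0 \<psi> 3 a(1)]
    have "0 < a powr (n - \<alpha>) * ((b - b0) / (n - \<alpha>) - c * base \<kappa> a powr (- m - 1))"
      using a by simp
    also have "\<dots> = profile_flux \<kappa> a + (b - b0) / (n - \<alpha>) * a powr (n - \<alpha>)"
      by (simp add: profile_flux_def c_def A_def algebra_simps)
    finally have "p a > 0" using cmp(2) by simp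
    moreover have "\<psi> a > 0"
      using cmp(1) a(3) by (simp add: profile_lap_def c_def A_def)
    moreover have "P a > 0"
    proof -
      have flux: "flux \<psi> P (\<lambda>r. \<phi> r powr q) r" if "r > 0" for r
        using sol [OF that] by (simp add: solves_def)
      have "a / 2 > 0" using \<open>a > 0\<close> by simp
      have "P (a / 2) \<ge> 0 / (n - \<alpha>) * (a / 2) powr (n - \<alpha>)"
        by (rule flux_ge(1) [OF \<open>a / 2 > 0\<close> flux _ \<psi>]) auto
      moreover have "P (a / 2) < P a"
      proof (rule DERIV_pos_imp_increasing [where f = P])
        fix x assume "a / 2 \<le> x"
        then have "x > 0" using \<open>a / 2 > 0\<close> by linarith
        then show "\<exists>d. (P has_real_derivative d) (at x) \<and> d > 0"
          using flux [of x] pos [of x]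
          by (intro exI [of _ "x powr (n - 1 - \<alpha>) * \<phi> x powr q"]) (simp add: flux_def)
      qed (use \<open>a > 0\<close> in simp)
      ultimately show ?thesis by simp
    qed
    ultimately have False
      using no_growing_solution [OF sol a(1)] pos [OF a(1)] by blast
    then show ?thesis ..
  qed
qed

end

section \<open>From radial solutions to the ordinary differential equation and back\<close>

lemma has_real_derivative_along_axis:
  fixes f :: "'a::euclidean_space \<Rightarrow> real"
  assumes "Ck_on (Suc k) f (- {0})" "e \<in> Basis" "r \<noteq> 0"
  shows "((\<lambda>r. f (r *\<^sub>R e)) has_real_derivative partial_deriv e f (r *\<^sub>R e)) (at r)"
proof -
  have "r *\<^sub>R e \<in> - {0}" using assms(2,3) by auto
  note d = Ck_on_has_derivative [OF assms(1) this]
  have "((\<lambda>r. f (r *\<^sub>R e)) has_derivative (\<lambda>h. frechet_derivative f (at (r *\<^sub>R e)) (h *\<^sub>R e))) (at r)"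
    by (rule has_derivative_compose [where f = "\<lambda>r. r *\<^sub>R e" and g = f, OF _ d])
      (auto intro!: derivative_eq_intros)
  moreover have "frechet_derivative f (at (r *\<^sub>R e)) (h *\<^sub>R e) = partial_deriv e f (r *\<^sub>R e) * h" for h
    using linear_scale [OF has_derivative_linear [OF d]] by (simp add: partial_deriv_def)
  ultimately show ?thesis
    by (simp add: has_field_derivative_def)
qed

lemma norm_at_right_zero: "filterlim norm (at_right 0) (at (0::'a::euclidean_space))"
  unfolding filterlim_at
  by (intro conjI tendsto_norm_zero tendsto_ident_at) (simp add: eventually_at_filter)

context weighted_radial
begin

lemma crit_exp_eq:
  assumes "n = real DIM('a::euclidean_space)"
  shows "crit_exp TYPE('a) \<alpha> - 2 = q - 1"
proof -
  have "n - 4 + \<alpha> \<noteq> 0" using \<alpha>_gt by simp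
  then have "2 * (n - \<alpha>) = (q + 1) * (n - 4 + \<alpha>)"
    by (simp add: q_def distrib_right)
  then show ?thesis
    unfolding crit_exp_def assms [symmetric] using \<open>n - 4 + \<alpha> \<noteq> 0\<close> by simp
qed

lemma laplacian_flux:
  fixes u :: "'a::euclidean_space \<Rightarrow> real"
  assumes n: "n = real DIM('a)"
    and u: "\<And>x. x \<noteq> 0 \<Longrightarrow> u x = y (norm x)"
    and flux: "\<And>r. r > 0 \<Longrightarrow> flux y p g r"
    and "x \<noteq> 0"
  shows "laplacian u x = norm x powr (- \<alpha>) * g (norm x)"
proof -
  have "laplacian u x = norm x powr (1 - n) * (norm x powr (n - 1 - \<alpha>) * g (norm x))"
    using laplacian_radial [of u y p "\<lambda>r. r powr (n - 1 - \<alpha>) * g r", OF u _ _ \<open>x \<noteq> 0\<close>] flux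
    unfolding n [symmetric] by (auto simp: flux_def)
  also have "\<dots> = norm x powr (- \<alpha>) * g (norm x)"
    by (simp add: mult.assoc [symmetric] powr_add [symmetric])
  finally show ?thesis .
qed

text \<open>Restricting to a coordinate axis expresses all derivatives of the profile through iterated partial
  derivatives along one axis, so four of them exist. The regularity imposed across the origin becomes
  the existence of the limits of \<open>\<phi>\<close> and \<open>\<psi>\<close>.\<close>

lemma radial_solution_solves:
  fixes u :: "'a::euclidean_space \<Rightarrow> real"
  assumes n: "n = real DIM('a)" and sol: "positive_radial_solution \<alpha> u"
  shows "\<exists>\<phi> p \<psi> P L. (\<forall>x. u x = \<phi> (norm x)) \<and> (\<forall>r>0. solves \<phi> p \<psi> P r) \<and> (\<forall>r. \<phi> r > 0) \<and>
    (\<phi> \<longlongrightarrow> u 0) (at_right 0) \<and> (\<psi> \<longlongrightarrow> L) (at_right 0)"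
proof -
  have cont: "continuous_on UNIV u" and ck: "Ck_on 4 u (- {0})"
    and lim: "\<exists>L. (weighted_laplacian \<alpha> u \<longlongrightarrow> L) (at 0)"
    and eq: "\<And>x. x \<noteq> 0 \<Longrightarrow> laplacian (weighted_laplacian \<alpha> u) x =
          norm x powr (- \<alpha>) * (\<bar>u x\<bar> powr (crit_exp TYPE('a) \<alpha> - 2) * u x)"
    and rad: "\<And>x y. norm x = norm y \<Longrightarrow> u x = u y" and pos: "\<And>x. u x > 0"
    using sol unfolding positive_radial_solution_def is_solution_def radial_def by blast+
  obtain e :: 'a where e: "e \<in> Basis" using nonempty_Basis by blast
  have e0: "e \<noteq> 0" using e by auto
  have e0: "e \<noteq> 0" using e by auto
  define u1 where "u1 = partial_deriv e u"
  define u2 where "u2 = partial_deriv e u1"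
  define u3 where "u3 = partial_deriv e u2"
  define u4 where "u4 = partial_deriv e u3"
  have ck': "Ck_on (Suc 3) u (- {0})" "Ck_on (Suc 2) u1 (- {0})" "Ck_on (Suc 1) u2 (- {0})" "Ck_on (Suc 0) u3 (- {0})"
    using ck e by (simp_all add: u1_def u2_def u3_def numeral_eq_Suc)
  define \<phi> where "\<phi> r = u (r *\<^sub>R e)" for r
  define f1 where "f1 r = u1 (r *\<^sub>R e)" for r
  define f2 where "f2 r = u2 (r *\<^sub>R e)" for r
  define f3 where "f3 r = u3 (r *\<^sub>R e)" for r
  define f4 where "f4 r = u4 (r *\<^sub>R e)" for r
  have d: "(\<phi> has_real_derivative f1 r) (at r)" "(f1 has_real_derivative f2 r) (at r)"
    "(f2 has_real_derivative f3 r) (at r)" "(f3 has_real_derivative f4 r) (at r)" if "r > 0" for r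
    using has_real_derivative_along_axis [OF ck'(1) e, of r] has_real_derivative_along_axis [OF ck'(2) e, of r]
      has_real_derivative_along_axis [OF ck'(3) e, of r] has_real_derivative_along_axis [OF ck'(4) e, of r] that
    by (simp_all add: \<phi>_def [abs_def] f1_def [abs_def] f2_def [abs_def] f3_def [abs_def] f4_def
        u1_def u2_def u3_def u4_def)
  have u_eq: "u x = \<phi> (norm x)" for x
    unfolding \<phi>_def using e by (intro rad) simp
  define p where "p r = r powr (n - 1) * f1 r" for r
  define \<psi> where "\<psi> r = r powr \<alpha> * f2 r + (n - 1) * (r powr (\<alpha> - 1) * f1 r)" for r
  define \<psi>' where "\<psi>' r = (\<alpha> * r powr (\<alpha> - 1) * f2 r + f3 r * r powr \<alpha>) +
     (n - 1) * ((\<alpha> - 1) * r powr (\<alpha> - 1 - 1) * f1 r + f2 r * r powr (\<alpha> - 1))" for r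
  define P where "P r = r powr (n - 1) * \<psi>' r" for r
  have inv: "r powr (1 - n) * (r powr (n - 1) * z) = z" if "r > 0" for r z
    using that by (simp add: mult.assoc [symmetric] powr_add [symmetric])
  have pw: "((\<lambda>r. r powr c) has_real_derivative c * r powr (c - 1)) (at r)" if "r > 0" for r c
    using that by (rule has_real_derivative_powr)
  have \<phi>p: "flux \<phi> p \<psi> r" if r: "r > 0" for r
  proof -
    have "(p has_real_derivative (n - 1) * r powr (n - 1 - 1) * f1 r + f2 r * r powr (n - 1)) (at r)"
      unfolding p_def [abs_def] using r by (intro DERIV_mult d pw)
    moreover have "r powr (n - 1 - \<alpha>) * \<psi> r =
      (n - 1) * (r powr (n - 1 - \<alpha>) * r powr (\<alpha> - 1)) * f1 r + f2 r * (r powr (n - 1 - \<alpha>) * r powr \<alpha>)"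
      by (simp only: \<psi>_def distrib_left mult_ac add_ac)
    moreover have "r powr (n - 1 - \<alpha>) * r powr (\<alpha> - 1) = r powr (n - 1 - 1)"
      "r powr (n - 1 - \<alpha>) * r powr \<alpha> = r powr (n - 1)"
      by (simp_all flip: powr_add)
    ultimately show ?thesis
      using d(1) [OF r] by (simp add: flux_def p_def inv [OF r])
  qed
  have wl: "weighted_laplacian \<alpha> u x = \<psi> (norm x)" if "x \<noteq> 0" for x
  proof -
    have "weighted_laplacian \<alpha> u x = norm x powr \<alpha> * (norm x powr (- \<alpha>) * \<psi> (norm x))"
      using laplacian_flux [OF n u_eq \<phi>p that] by (simp add: weighted_laplacian_def)
    then show ?thesis
      using that by (simp add: mult.assoc [symmetric] powr_add [symmetric])
  qed
  have \<psi>': "(\<psi> has_real_derivative \<psi>' r) (at r)" if r: "r > 0" for r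
    unfolding \<psi>_def [abs_def] \<psi>'_def using r
    by (intro DERIV_add DERIV_cmult DERIV_mult d pw)
  define P' where "P' = deriv P"
  have P': "(P has_real_derivative P' r) (at r)" if r: "r > 0" for r
  proof -
    have "(\<lambda>r. r powr c) differentiable (at r)" for c
      unfolding real_differentiable_def
      using r has_real_derivative_powr by blast
    moreover have "f1 differentiable (at r)" "f2 differentiable (at r)" "f3 differentiable (at r)"
      unfolding real_differentiable_def using d [OF r] by blast+
    ultimately show ?thesis
      unfolding P'_def DERIV_deriv_iff_real_differentiable P_def [abs_def] \<psi>'_def
      by (intro differentiable_add differentiable_mult differentiable_const)
  qed
  have eq': "P' r = r powr (n - 1 - \<alpha>) * \<phi> r powr q" if r: "r > 0" for r
  proof -
    have ne: "r *\<^sub>R e \<noteq> 0" and nr: "norm (r *\<^sub>R e) = r" using e r by auto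
    have "laplacian (weighted_laplacian \<alpha> u) (r *\<^sub>R e) = r powr (1 - n) * P' r"
      using laplacian_radial [of "weighted_laplacian \<alpha> u" \<psi> P P' "r *\<^sub>R e", OF wl _ P' ne] \<psi>'
      unfolding nr n [symmetric] by (simp add: P_def inv)
    then have "r powr (1 - n) * P' r = r powr (- \<alpha>) * (\<phi> r powr (q - 1) * \<phi> r)"
      using eq [OF ne] pos [of "r *\<^sub>R e"] unfolding nr crit_exp_eq [OF n] by (simp add: \<phi>_def)
    then have "r powr (n - 1) * (r powr (1 - n) * P' r) = r powr (n - 1) * (r powr (- \<alpha>) * \<phi> r powr q)"
      using powr_add [of "\<phi> r" "q - 1" 1] pos [of "r *\<^sub>R e"] by (simp add: \<phi>_def)
    then show ?thesis
      using r by (simp add: mult.assoc [symmetric] powr_add [symmetric])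
  qed
  obtain L where L: "(weighted_laplacian \<alpha> u \<longlongrightarrow> L) (at 0)" using lim by blast
  show ?thesis
  proof (rule exI [of _ \<phi>], rule exI [of _ p], rule exI [of _ \<psi>], rule exI [of _ P], rule exI [of _ L],
      intro conjI allI impI)
    show "u x = \<phi> (norm x)" for x by (rule u_eq)
    show "solves \<phi> p \<psi> P r" if "r > 0" for r
      using \<phi>p [OF that] \<psi>' [OF that] P' [OF that]
      by (simp add: solves_def flux_def P_def inv [OF that] flip: eq' [OF that])
    show "\<phi> r > 0" for r by (simp add: \<phi>_def pos)
    have "isCont \<phi> 0"
      unfolding \<phi>_def [abs_def] using cont
      by (intro isCont_o2 [OF _ continuous_on_interior [of UNIV u]]) (auto intro: continuous_intros)
    then show "(\<phi> \<longlongrightarrow> u 0) (at_right 0)"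
      by (simp add: isCont_def filterlim_at_split \<phi>_def)
    have "filterlim (\<lambda>r. r *\<^sub>R e) (at 0) (at_right 0)"
      using e0 by (auto simp: filterlim_at eventually_at_filter intro!: tendsto_eq_intros)
    from filterlim_compose [OF L this] have "((\<lambda>r. weighted_laplacian \<alpha> u (r *\<^sub>R e)) \<longlongrightarrow> L) (at_right 0)" .
    moreover have "\<forall>\<^sub>F r in at_right 0. weighted_laplacian \<alpha> u (r *\<^sub>R e) = \<psi> r"
      using e e0 by (intro eventually_at_rightI [of 0 1]) (auto simp: wl)
    ultimately show "(\<psi> \<longlongrightarrow> L) (at_right 0)"
      by (simp cong: filterlim_cong)
  qed
qed

text \<open>Smoothness off the origin is read off from the formula in terms of \<open>x \<bullet> x\<close>, which, unlike the
  norm, has polynomial derivatives.\<close>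

lemma profile_positive_radial_solution:
  assumes n: "n = real DIM('a::euclidean_space)" and "\<kappa> > 0"
  shows "positive_radial_solution \<alpha> (\<lambda>x::'a. profile \<kappa> (norm x))"
proof -
  define u :: "'a \<Rightarrow> real" where "u x = profile \<kappa> (norm x)" for x
  have base_pos: "base \<kappa> r > 0" for r
    using \<open>\<kappa> > 0\<close> by (simp add: base_def add_pos_nonneg)
  then have pos: "profile \<kappa> r > 0" for r
    using amplitude_pos [of \<kappa>] \<open>\<kappa> > 0\<close> by (simp add: profile_def less_imp_neq [symmetric])
  have sol: "flux (profile \<kappa>) (profile_flux \<kappa>) (profile_lap \<kappa>) r"
    "flux (profile_lap \<kappa>) (profile_lap_flux \<kappa>) (\<lambda>r. profile \<kappa> r powr q) r" if "r > 0" for r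
    using profile_solves [OF that base_pos] \<open>\<kappa> > 0\<close> by (auto simp: solves_def)
  have wl: "weighted_laplacian \<alpha> u x = profile_lap \<kappa> (norm x)" if "x \<noteq> 0" for x
    using laplacian_flux [OF n _ sol(1) that, of u] that
    by (simp add: weighted_laplacian_def u_def mult.assoc [symmetric] powr_add [symmetric])
  have cont: "continuous_on UNIV u"
    unfolding u_def profile_def base_def using \<gamma>_pos base_pos [unfolded base_def]
    by (auto intro!: continuous_intros continuous_on_powr' simp: less_imp_le less_imp_neq [symmetric])
  have "Ck_on 4 u (- {0})"
  proof -
    have op: "open (- {0::'a})" by auto
    have "u x = amplitude \<kappa> * (1 + \<kappa> * (x \<bullet> x) powr (\<gamma> / 2)) powr (- m)" for x
      by (simp add: u_def profile_def base_def norm_eq_sqrt_inner powr_half_sqrt [symmetric] powr_powr)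
    then have "u = (\<lambda>x. amplitude \<kappa> * (1 + \<kappa> * (x \<bullet> x) powr (\<gamma> / 2)) powr (- m))" by blast
    moreover have "Ck_on 4 \<dots> (- {0})"
      using \<open>\<kappa> > 0\<close>
      by (intro Ck_on_mult Ck_on_powr Ck_on_add Ck_on_const Ck_on_inner_self op)
        (auto intro!: add_pos_nonneg)
    ultimately show ?thesis by simp
  qed
  moreover have "\<exists>L. (weighted_laplacian \<alpha> u \<longlongrightarrow> L) (at 0)"
  proof
    have "\<forall>\<^sub>F x in at 0. profile_lap \<kappa> (norm x) = weighted_laplacian \<alpha> u x"
      by (auto simp: eventually_at_filter wl)
    then show "(weighted_laplacian \<alpha> u \<longlongrightarrow> - (amplitude \<kappa> * m * \<kappa> * \<gamma>) * (n - 2 + \<gamma>)) (at 0)"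
      using filterlim_compose [OF profile_at_origin(2) norm_at_right_zero, of \<kappa>]
      by (rule Lim_transform_eventually [rotated])
  qed
  moreover have "laplacian (weighted_laplacian \<alpha> u) x =
          norm x powr (- \<alpha>) * (\<bar>u x\<bar> powr (crit_exp TYPE('a) \<alpha> - 2) * u x)" if "x \<noteq> 0" for x
    using laplacian_flux [OF n wl sol(2) that] pos [of "norm x"] powr_add [of "u x" "q - 1" 1]
    unfolding crit_exp_eq [OF n] by (simp add: u_def)
  moreover have "radial u" by (simp add: radial_def u_def)
  ultimately show ?thesis
    using cont pos unfolding u_def [abs_def, symmetric]
    by (simp add: positive_radial_solution_def is_solution_def) (simp add: u_def)
qed

lemma bubble_eq_profile:
  assumes n: "n = real DIM('a::euclidean_space)" and "l > 0"
  shows "bubble \<alpha> l (x::'a) = profile (l powr \<gamma>) (norm x)"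
proof -
  have "8 - 4 * \<alpha> = (2 - \<alpha>) * 4" by simp
  then have e: "(n - 4 + \<alpha>) / (8 - 4 * \<alpha>) = m / 4"
    by (simp only: m_def divide_divide_eq_left)
  have "l powr ((n - 4 + \<alpha>) / 2) = (l powr \<gamma>) powr (m / 2)"
    unfolding m_\<gamma> [symmetric] by (simp add: powr_powr mult.commute)
  moreover have "bubble_const TYPE('a) \<alpha> = bubble_factor powr (m / 4)"
    unfolding bubble_const_def n [symmetric] Let_def bubble_factor_def e ..
  ultimately have "bubble \<alpha> l x =
      bubble_factor powr (m / 4) * (l powr \<gamma>) powr (m / 2) / (1 + l powr \<gamma> * norm x powr \<gamma>) powr m"
    unfolding bubble_def n [symmetric] Let_def by (simp only: m_def \<gamma>_def)
  then show ?thesis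
    by (simp add: profile_def amplitude_def base_def powr_minus_divide)
qed

lemma dilation_bubble:
  assumes "l > 0" "t > 0"
  shows "dilation \<alpha> t (bubble \<alpha> l :: 'a::euclidean_space \<Rightarrow> real) = bubble \<alpha> (t * l)"
proof
  fix x :: 'a
  have e: "t powr z * l powr z = (t * l) powr z" for z
    using assms by (simp add: powr_mult)
  have "l powr (2 - \<alpha>) * norm (t *\<^sub>R x) powr (2 - \<alpha>) = (t * l) powr (2 - \<alpha>) * norm x powr (2 - \<alpha>)"
    using assms by (simp add: powr_mult)
  then show "dilation \<alpha> t (bubble \<alpha> l) x = bubble \<alpha> (t * l) x"
    unfolding dilation_def bubble_def Let_def
    by (simp only: times_divide_eq_right mult.left_commute [of "t powr z" for z] e)
qed

text \<open>The amplitude runs through all positive numbers, so some profile matches the solution at the origin.\<close>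

lemma positive_radial_solution_eq_bubble:
  fixes u :: "'a::euclidean_space \<Rightarrow> real"
  assumes n: "n = real DIM('a)" and sol: "positive_radial_solution \<alpha> u"
  shows "\<exists>l>0. u = bubble \<alpha> l"
proof -
  obtain \<phi> p \<psi> P L where \<phi>: "\<forall>x. u x = \<phi> (norm x)" "\<forall>r>0. solves \<phi> p \<psi> P r"
    "\<forall>r. \<phi> r > 0" "(\<phi> \<longlongrightarrow> u 0) (at_right 0)" "(\<psi> \<longlongrightarrow> L) (at_right 0)"
    using radial_solution_solves [OF n sol] by blast
  have "u 0 > 0" using \<phi>(1,3) by simp
  define \<kappa> where "\<kappa> = (u 0 / bubble_factor powr (m / 4)) powr (2 / m)"
  have \<kappa>: "\<kappa> > 0" "amplitude \<kappa> = u 0"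
    using \<open>u 0 > 0\<close> bubble_factor_pos m_pos by (auto simp: \<kappa>_def amplitude_def powr_powr)
  define l where "l = \<kappa> powr (1 / \<gamma>)"
  have l: "l > 0" "l powr \<gamma> = \<kappa>"
    using \<kappa>(1) \<gamma>_pos by (auto simp: l_def powr_powr)
  have "u x = bubble \<alpha> l x" for x
  proof (cases "x = 0")
    case True
    then show ?thesis
      by (simp add: bubble_eq_profile [OF n l(1)] l(2) profile_def base_def \<kappa>(2))
  next
    case False
    then show ?thesis
      using positive_solution_eq_profile [OF \<phi>(2,3) [rule_format] \<kappa>(1) _ \<phi>(5), of "norm x"] \<phi>(1,4)
      by (simp add: bubble_eq_profile [OF n l(1)] l(2) \<kappa>(2))
  qed
  then show ?thesis using l(1) by blast
qed

end

theorem corollary1p2: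
  fixes \<alpha> :: real
  assumes "DIM('a::euclidean_space) \<ge> 3"
    and "4 - real DIM('a) < \<alpha>" and "\<alpha> < 2"
  shows "(\<forall>l>0. positive_radial_solution \<alpha> (bubble \<alpha> l :: 'a \<Rightarrow> real)) \<and>
         (\<forall>u :: 'a \<Rightarrow> real. positive_radial_solution \<alpha> u \<longrightarrow> (\<exists>l>0. u = bubble \<alpha> l)) \<and>
         (\<forall>u v :: 'a \<Rightarrow> real. positive_radial_solution \<alpha> u \<longrightarrow> positive_radial_solution \<alpha> v \<longrightarrow>
            (\<exists>l>0. v = dilation \<alpha> l u))"
proof -
  interpret weighted_radial "real DIM('a)" \<alpha>
    by unfold_locales (use assms in auto)
  have existence: "positive_radial_solution \<alpha> (bubble \<alpha> l :: 'a \<Rightarrow> real)" if "l > 0" for l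
  proof -
    have "bubble \<alpha> l = (\<lambda>x::'a. profile (l powr \<gamma>) (norm x))"
      using bubble_eq_profile [OF refl that] by blast
    then show ?thesis
      using profile_positive_radial_solution [OF refl, of "l powr \<gamma>"] that by simp
  qed
  have uniqueness: "\<exists>l>0. u = bubble \<alpha> l" if "positive_radial_solution \<alpha> u" for u :: "'a \<Rightarrow> real"
    using positive_radial_solution_eq_bubble [OF refl that] .
  have "\<exists>l>0. v = dilation \<alpha> l u"
    if u_sol: "positive_radial_solution \<alpha> u" and v_sol: "positive_radial_solution \<alpha> v" for u v :: "'a \<Rightarrow> real"
  proof -
    obtain l where "l > 0" and u: "u = bubble \<alpha> l" using uniqueness [OF u_sol] by blast
    obtain k where "k > 0" and v: "v = bubble \<alpha> k" using uniqueness [OF v_sol] by blast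
    have "k / l > 0" using \<open>k > 0\<close> \<open>l > 0\<close> by simp
    moreover have "v = dilation \<alpha> (k / l) u"
      unfolding u v dilation_bubble [OF \<open>l > 0\<close> \<open>k / l > 0\<close>] using \<open>l > 0\<close> by simp
    ultimately show ?thesis by blast
  qed
  then show ?thesis using existence uniqueness by blast
qed

end
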